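(* Let $(X,\rho)$ be a compact path-connected metric space with diameter $\pi$. Let $r\in\mathbb{N}$ and $0=t_0<t_1<\cdots<t_\ell=\pi$. Let $\Phi\in C[0,\pi]$ satisfy $|\Phi(s)-\Phi(s')|\le|s-s'|$ for all $s,s'\in[0,\pi]$ and belong to the class $\mathcal{S}_r(t_1,\dots,t_\ell)$ (for the space $(X,\rho)$). Let $\beta\ge1$, $c_1>1$, $c_2>1$ be constants and let $\mu$ be a non-atomic Borel probability measure on $X$ such that $$\inf_{x\in X}\mu(B_t(x))\ge\Bigl(\frac{8}{c_1}\Bigr)^{\beta}t^\beta\quad\text{for all }0<t\le1,$$ and such that for each $x\in X$, each $\delta\in(0,\pi)$ and each $1\le j<\ell$, $$\mu\bigl(E(x;t_j-\delta,t_j+\delta)\bigr)\le c_2\delta .$$ Then for any $g\in L^\infty(X,d\mu)$ with $\|g\|_{L^\infty(d\mu)}\le1$ and each integer $N\ge20$, there exist points $y_1,\dots,y_{2(r+2)N}\in X$ and real numbers $\lambda_1,\dots,\lambda_{2(r+2)N}$ such that $$\max_{x\in X}\left|\int_X\Phi(\rho(x,y))g(y)\,d\mu(y)-\sum_{j=1}^{2(r+2)N}\lambda_j\Phi(\rho(x,y_j))\right|\le45\,c_3\,N^{-\frac12-\frac{3}{2\beta}}\sqrt{\log N},$$ where $c_3=8c_1^2\sqrt{c_2\ell}\,\sqrt{\beta}$.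
   Context: $B_t(x)=\{y\in X:\rho(x,y)<t\}$. For $x\in X$ and real $a<b$, $E(x;a,b)=\{y\in X: a\le\rho(x,y)\le b\}$. Class $\mathcal{S}_r(t_1,\dots,t_\ell)$: a function $\Phi\in C[0,\pi]$ belongs to it if there exists an $r$-dimensional linear subspace $V_r$ of $C(X)$ such that for every $x\in X$ and each $1\le j\le\ell$ there is $f\in V_r$ with $\Phi(\rho(x,y))=f(y)$ for all $y\in E(x;t_{j-1},t_j)$. All functions are real-valued. *)

theory Defs
  imports "HOL-Probability.Probability"
begin

text \<open>The compact metric space \<open>X\<close> is the universe of a type of class \<open>metric_space\<close>.  Since \<open>X\<close> is
  compact, \<open>C(X)\<close> is the type \<open>'a \<Rightarrow>\<^sub>C real\<close> of bounded continuous functions.\<close>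

definition shell :: "'a::metric_space \<Rightarrow> real \<Rightarrow> real \<Rightarrow> 'a set" where
  "shell x a b = {y. a \<le> dist x y \<and> dist x y \<le> b}"

text \<open>\<open>dim\<close> is \<open>0\<close> on spaces of infinite dimension, so finite dimensionality has to be required
  separately to exclude those when \<open>r = 0\<close>.\<close>

definition has_dim :: "'v::real_vector set \<Rightarrow> nat \<Rightarrow> bool" where
  "has_dim V r \<longleftrightarrow> subspace V \<and> (\<exists>B. finite B \<and> V \<subseteq> span B) \<and> dim V = r"

text \<open>The class \<open>S\<^sub>r(t\<^sub>1, \<dots>, t\<^sub>l)\<close>; \<open>t\<close> also carries \<open>t 0 = 0\<close>, and its values beyond \<open>l\<close> are irrelevant.
  The function \<open>f\<close> may depend on both \<open>x\<close> and \<open>j\<close>, but \<open>V\<close> may not.\<close>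

definition S_class ::
    "'a::metric_space itself \<Rightarrow> nat \<Rightarrow> nat \<Rightarrow> (nat \<Rightarrow> real) \<Rightarrow> (real \<Rightarrow> real) set" where
  "S_class (_ :: 'a itself) r l t =
     {\<Phi>. continuous_on {0..pi} \<Phi> \<and>
        (\<exists>V :: ('a \<Rightarrow>\<^sub>C real) set. has_dim V r \<and>
          (\<forall>x. \<forall>j\<in>{1..l}. \<exists>f\<in>V. \<forall>y\<in>shell x (t (j - 1)) (t j). \<Phi> (dist x y) = apply_bcontfun f y))}"

definition nonatomic :: "'a measure \<Rightarrow> bool" where
  "nonatomic M \<longleftrightarrow>
     (\<forall>A\<in>sets M. 0 < emeasure M A \<longrightarrow>
        (\<exists>B\<in>sets M. B \<subseteq> A \<and> 0 < emeasure M B \<and> emeasure M B < emeasure M A))"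

text \<open>The \<open>L\<^sup>\<infinity>\<close> norm; it is \<open>\<infinity>\<close> if \<open>g\<close> is essentially unbounded.\<close>

definition Linf_norm :: "'a measure \<Rightarrow> ('a \<Rightarrow> real) \<Rightarrow> ereal" where
  "Linf_norm M g = esssup M (\<lambda>x. ereal \<bar>g x\<bar>)"

end

theory Submission
  imports Defs
begin

text \<open>Cover \<open>X\<close> by at most \<open>N\<close> cells of diameter at most \<open>\<delta> \<sim> N\<^bsup>-1/\<beta>\<^esup>\<close> and split each
  cell into fractional copies, giving at most \<open>2 N\<close> pieces of mass at most \<open>1 / N\<close>.  On every piece
  replace \<open>g d\<mu>\<close> by a signed measure with at most \<open>r + 2\<close> atoms that has the same moments against
  \<open>V\<^sub>r\<close> and the constants, and the same weight.  For a given \<open>x\<close> the pieces inside one shell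
  \<open>E(x; t\<^bsub>j-1\<^esub>, t\<^sub>j)\<close> then contribute no error, and the others lie near some \<open>\<rho>(x, \<cdot>) = t\<^sub>j\<close>,
  so they have total mass \<open>O(\<delta>)\<close> and an error of at most \<open>2 \<delta>\<close> times their mass.  A Hoeffding type
  choice of the atoms, made for all \<open>x\<close> in a finite net at once, yields an error of order
  \<open>(\<delta>\<^sup>3 log N / N)\<^bsup>1/2\<^esup>\<close>.  To keep the choice finite and deterministic, \<open>g d\<mu>\<close> is first replaced
  by a finite sum of point masses; then sparse measures are basic solutions of a linear program, and
  the random selection is derandomised.\<close>

section \<open>Linear algebra: sparse solutions of moment equations\<close>

text \<open>Gaussian elimination, one equation at a time. If equation \<open>i\<close> has a nonzero
  coefficient at a pivot \<open>k0\<close>, the unknown \<open>c k0\<close> is expressed by the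
  others and substituted, which leaves one equation and one unknown fewer. If all its coefficients
  vanish, equation \<open>i\<close> holds for every \<open>c\<close>.\<close>

lemma exists_linear_dependency:
  fixes f :: "'j \<Rightarrow> 'k \<Rightarrow> real"
  assumes "finite J" "finite K" "card J < card K"
  shows "\<exists>c. (\<exists>k\<in>K. c k \<noteq> 0) \<and> (\<forall>j\<in>J. (\<Sum>k\<in>K. c k * f j k) = 0)"
  using assms
proof (induction J arbitrary: K f rule: finite_induct)
  case empty
  then have "K \<noteq> {}" by auto
  then show ?case by (intro exI[of _ "\<lambda>_. 1"]) auto
next
  case (insert i J)
  show ?case
  proof (cases "\<forall>k\<in>K. f i k = 0")
    case True
    obtain c where "\<exists>k\<in>K. c k \<noteq> 0" "\<forall>j\<in>J. (\<Sum>k\<in>K. c k * f j k) = 0"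
      using insert.IH[of K f] insert.prems insert.hyps by auto
    with True show ?thesis by (intro exI[of _ c]) auto
  next
    case False
    then obtain k0 where k0: "k0 \<in> K" "f i k0 \<noteq> 0" by auto
    define K' where "K' = K - {k0}"
    have K: "K = insert k0 K'" "k0 \<notin> K'" "finite K'"
      using k0 insert.prems by (auto simp: K'_def)
    define f' where "f' = (\<lambda>j k. f j k - f i k / f i k0 * f j k0)"
    have "card J < card K'" using insert.prems insert.hyps K by simp
    then obtain c' where c': "\<exists>k\<in>K'. c' k \<noteq> 0" "\<And>j. j \<in> J \<Longrightarrow> (\<Sum>k\<in>K'. c' k * f' j k) = 0"
      using insert.IH[of K' f'] K by auto
    define s where "s = (\<Sum>k\<in>K'. c' k * f i k)"
    define c where "c = (\<lambda>k. if k = k0 then - s / f i k0 else c' k)"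
    have sum_c: "(\<Sum>k\<in>K. c k * f j k) = - s / f i k0 * f j k0 + (\<Sum>k\<in>K'. c' k * f j k)" for j
    proof -
      have "(\<Sum>k\<in>K'. c k * f j k) = (\<Sum>k\<in>K'. c' k * f j k)"
        using K(2) by (intro sum.cong) (auto simp: c_def)
      then show ?thesis using K by (simp add: c_def)
    qed
    have "(\<Sum>k\<in>K. c k * f j k) = 0" if "j \<in> insert i J" for j
    proof (cases "j = i")
      case True
      then show ?thesis unfolding sum_c using k0 by (simp add: s_def)
    next
      case False
      have "(\<Sum>k\<in>K'. c' k * f' j k) = (\<Sum>k\<in>K'. c' k * f j k) - s / f i k0 * f j k0"
        by (simp add: f'_def s_def right_diff_distrib sum_subtractf sum_divide_distrib
            sum_distrib_right mult.assoc)
      then show ?thesis using False that c'(2)[of j] unfolding sum_c by simp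
    qed
    moreover have "\<exists>k\<in>K. c k \<noteq> 0"
      using c'(1) K by (auto simp: c_def)
    ultimately show ?thesis by blast
  qed
qed

text \<open>A basic solution of the linear program that minimises \<open>b \<mapsto> \<Sum>k. b k * L k\<close> under the moment
  constraints.  The constraint \<open>\<Sum>b = \<Sum>a\<close> forces every dependency to have a negative entry, so that
  moving along it reaches the boundary of the positive orthant.\<close>

lemma sparse_nonneg_solution:
  fixes f :: "'j \<Rightarrow> 'k \<Rightarrow> real" and a L :: "'k \<Rightarrow> real"
  assumes "finite J" "finite K" "\<And>k. k \<in> K \<Longrightarrow> 0 \<le> a k"
  shows "\<exists>b. (\<forall>k\<in>K. 0 \<le> b k) \<and> card {k\<in>K. b k \<noteq> 0} \<le> Suc (card J) \<and>
           (\<forall>j\<in>J. (\<Sum>k\<in>K. b k * f j k) = (\<Sum>k\<in>K. a k * f j k)) \<and>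
           sum b K = sum a K \<and> (\<Sum>k\<in>K. b k * L k) \<le> (\<Sum>k\<in>K. a k * L k)"
  using assms(3)
proof (induction "card {k\<in>K. a k \<noteq> 0}" arbitrary: a rule: less_induct)
  case less
  show ?case
  proof (cases "card {k\<in>K. a k \<noteq> 0} \<le> Suc (card J)")
    case True
    then show ?thesis using less.prems by (intro exI[of _ a]) auto
  next
    case False
    define S where "S = {k\<in>K. a k \<noteq> 0}"
    have S: "finite S" "S \<subseteq> K" using assms by (auto simp: S_def)
    \<comment> \<open>The index \<open>None\<close> carries the constant function 1, so that the
      dependency also preserves the total mass.\<close>
    define f' where "f' = case_option (\<lambda>k. 1) f"
    have "card (insert None (Some ` J)) < card S"
      using False assms(1) by (simp add: S_def card_image)
    then obtain c0 where c0: "\<exists>k\<in>S. c0 k \<noteq> 0"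
        "\<And>j. j \<in> insert None (Some ` J) \<Longrightarrow> (\<Sum>k\<in>S. c0 k * f' j k) = 0"
      using exists_linear_dependency[of "insert None (Some ` J)" S f'] assms(1) S by auto
    have c0_1: "sum c0 S = 0" using c0(2)[of None] by (simp add: f'_def)
    have c0_f: "(\<Sum>k\<in>S. c0 k * f j k) = 0" if "j \<in> J" for j
      using c0(2)[of "Some j"] that by (simp add: f'_def)
    \<comment> \<open>The negative of a dependency is again a dependency; the sign is chosen so that
      moving along it does not increase the objective \<open>L\<close>.\<close>
    define \<sigma> :: real where "\<sigma> = (if (\<Sum>k\<in>S. c0 k * L k) \<le> 0 then 1 else -1)"
    define c where "c = (\<lambda>k. if k \<in> S then \<sigma> * c0 k else 0)"
    have sum_c: "(\<Sum>k\<in>K. c k * h k) = \<sigma> * (\<Sum>k\<in>S. c0 k * h k)" for h :: "'k \<Rightarrow> real"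
    proof -
      have "(\<Sum>k\<in>K. c k * h k) = (\<Sum>k\<in>S. c k * h k)"
        using S assms by (intro sum.mono_neutral_right) (auto simp: c_def)
      then show ?thesis by (simp add: c_def sum_distrib_left mult.assoc)
    qed
    have c_1: "sum c K = 0" using sum_c[of "\<lambda>_. 1"] c0_1 by simp
    have c_f: "(\<Sum>k\<in>K. c k * f j k) = 0" if "j \<in> J" for j
      using sum_c c0_f[OF that] by simp
    have c_L: "(\<Sum>k\<in>K. c k * L k) \<le> 0" by (auto simp: sum_c \<sigma>_def)
    have "\<exists>k\<in>K. c k < 0"
    proof (rule ccontr)
      assume "\<not> ?thesis"
      then have "\<And>k. k \<in> K \<Longrightarrow> 0 \<le> c k" by (meson not_le)
      then have "\<forall>k\<in>K. c k = 0"
        using sum_nonneg_eq_0_iff[OF assms(2), of c] c_1 by blast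
      moreover have "\<exists>k\<in>K. c k \<noteq> 0" using c0(1) S by (auto simp: c_def \<sigma>_def)
      ultimately show False by blast
    qed
    define G where "G = {k\<in>K. c k < 0}"
    have G: "finite G" "G \<noteq> {}" "G \<subseteq> S"
      using assms(2) \<open>\<exists>k\<in>K. c k < 0\<close> by (auto simp: G_def c_def split: if_splits)
    \<comment> \<open>The longest step along \<open>c\<close> that keeps all weights nonnegative.
      The index attaining the minimum leaves the support, and no index enters it because
      \<open>c\<close> vanishes off \<open>S\<close>.\<close>
    define \<tau> where "\<tau> = Min ((\<lambda>k. a k / - c k) ` G)"
    have "\<tau> \<in> (\<lambda>k. a k / - c k) ` G" unfolding \<tau>_def using G by (intro Min_in) auto
    then obtain k0 where k0: "k0 \<in> G" "\<tau> = a k0 / - c k0" by auto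
    have \<tau>_le: "\<tau> \<le> a k / - c k" if "k \<in> G" for k
      unfolding \<tau>_def using G that by (intro Min_le) auto
    have "0 \<le> \<tau>" using k0 less.prems[of k0] by (auto simp: G_def intro!: divide_nonneg_neg)
    define a' where "a' = (\<lambda>k. a k + \<tau> * c k)"
    have nonneg: "0 \<le> a' k" if "k \<in> K" for k
    proof (cases "k \<in> G")
      case True
      then have "c k < 0" by (simp add: G_def)
      with \<tau>_le[OF True] show ?thesis by (simp add: a'_def field_simps)
    next
      case False
      then show ?thesis using that \<open>0 \<le> \<tau>\<close> less.prems[of k] by (auto simp: a'_def G_def)
    qed
    have "a' k0 = 0" using k0 by (auto simp: a'_def G_def)
    moreover have "a' k = 0" if "k \<in> K" "a k = 0" for k
      using that by (auto simp: a'_def c_def S_def)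
    ultimately have "{k\<in>K. a' k \<noteq> 0} \<subset> {k\<in>K. a k \<noteq> 0}"
      using k0 G(3) by (auto simp: S_def)
    then have "card {k\<in>K. a' k \<noteq> 0} < card {k\<in>K. a k \<noteq> 0}"
      using assms(2) by (intro psubset_card_mono) auto
    from less.hyps[OF this nonneg] obtain b where b:
        "\<forall>k\<in>K. 0 \<le> b k" "card {k\<in>K. b k \<noteq> 0} \<le> Suc (card J)"
        "\<And>j. j\<in>J \<Longrightarrow> (\<Sum>k\<in>K. b k * f j k) = (\<Sum>k\<in>K. a' k * f j k)"
        "sum b K = sum a' K" "(\<Sum>k\<in>K. b k * L k) \<le> (\<Sum>k\<in>K. a' k * L k)"
      by blast
    have sum_a': "(\<Sum>k\<in>K. a' k * h k) = (\<Sum>k\<in>K. a k * h k) + \<tau> * (\<Sum>k\<in>K. c k * h k)"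
      for h :: "'k \<Rightarrow> real"
      by (simp add: a'_def distrib_right sum.distrib sum_distrib_left mult.assoc)
    have "\<tau> * (\<Sum>k\<in>K. c k * L k) \<le> 0"
      using c_L \<open>0 \<le> \<tau>\<close> by (rule mult_nonneg_nonpos[rotated])
    then show ?thesis
      using b c_f c_1 sum_a' sum_a'[of "\<lambda>_. 1"] by (intro exI[of _ b]) auto
  qed
qed

section \<open>Exponential inequalities and balanced choices\<close>

text \<open>\<open>cosh y\<close> is the moment generating function of a fair sign. Hoeffding's
  lemma with probability 1/2 and interval length \<open>h = 2 * \<bar>y\<bar>\<close> applies, and
  \<open>h\<^sup>2 / 8 = y\<^sup>2 / 2\<close>.\<close>

lemma cosh_le_exp_half_square: "cosh (y::real) \<le> exp (y\<^sup>2 / 2)"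
proof -
  define h where "h = 2 * \<bar>y\<bar>"
  have "- h * (1/2) + ln (1 + (1/2) * (exp h - 1)) \<le> h\<^sup>2 / 8"
    by (rule Hoeffdings_lemma_aux) (auto simp: h_def)
  then have "ln (1 + (1/2) * (exp h - 1)) \<le> \<bar>y\<bar> + y\<^sup>2 / 2"
    by (simp add: h_def power_mult_distrib)
  moreover have "0 < 1 + (1/2) * (exp h - 1)"
    using exp_gt_zero[of h] by (simp add: field_simps add_pos_pos)
  ultimately have "1 + (1/2) * (exp h - 1) \<le> exp (\<bar>y\<bar> + y\<^sup>2 / 2)"
    by (metis exp_le_cancel_iff exp_ln)
  then have "exp (- \<bar>y\<bar>) * (1 + (1/2) * (exp h - 1)) \<le> exp (- \<bar>y\<bar>) * exp (\<bar>y\<bar> + y\<^sup>2 / 2)"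
    by (intro mult_left_mono) auto
  also have "\<dots> = exp (y\<^sup>2 / 2)" by (simp add: exp_add[symmetric])
  also have "exp (- \<bar>y\<bar>) * (1 + (1/2) * (exp h - 1)) = cosh \<bar>y\<bar>"
    by (simp add: h_def cosh_field_def field_simps exp_add[symmetric])
  finally show ?thesis by simp
qed

text \<open>By convexity, \<open>exp\<close> lies below its chord between
  \<open>- (\<theta> * B)\<close> and \<open>\<theta> * B\<close>. For \<open>B = 0\<close> the
  quotient \<open>z / B\<close> is 0 by convention and \<open>z = 0\<close>; this case occurs for
  cells that carry no error.\<close>

lemma exp_le_chord:
  fixes z B \<theta> :: real
  assumes "\<bar>z\<bar> \<le> B"
  shows "exp (\<theta> * z) \<le> cosh (\<theta> * B) + z / B * sinh (\<theta> * B)"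
proof (cases "B = 0")
  case True
  with assms show ?thesis by simp
next
  case False
  then have B: "B > 0" using assms by simp
  define w where "w = z / B"
  define u where "u = (1 + w) / 2"
  have u: "0 \<le> u" "u \<le> 1" using assms B by (auto simp: u_def w_def field_simps)
  have eq: "\<theta> * z = u *\<^sub>R (\<theta> * B) + (1 - u) *\<^sub>R (- (\<theta> * B))"
    using B by (simp add: u_def w_def field_simps)
  have "exp (\<theta> * z) \<le> u * exp (\<theta> * B) + (1 - u) * exp (- (\<theta> * B))"
    unfolding eq using convex_onD[OF convex_on_exp[of 1], of u "- (\<theta> * B)" "\<theta> * B"] u
    by (simp add: add.commute)
  also have "\<dots> = cosh (\<theta> * B) + w * sinh (\<theta> * B)"
    by (simp add: u_def cosh_field_def sinh_field_def field_simps)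
  finally show ?thesis unfolding w_def .
qed

text \<open>The chord bound is used for both \<open>z\<close> and \<open>- z\<close>. The point is
  that the result is affine in \<open>z\<close>: after summation over \<open>x\<close>, the linear
  part is a functional that a suitable choice makes nonpositive.\<close>

lemma cosh_add_le_chord:
  fixes z B S :: real
  assumes "\<bar>z\<bar> \<le> B"
  shows "cosh (\<theta> * (S + z)) \<le> cosh (\<theta> * S) * cosh (\<theta> * B) + sinh (\<theta> * S) * (z / B * sinh (\<theta> * B))"
proof -
  have "exp (\<theta> * S) * exp (\<theta> * z) \<le> exp (\<theta> * S) * (cosh (\<theta> * B) + z / B * sinh (\<theta> * B))"
    using exp_le_chord[OF assms] by (intro mult_left_mono) auto
  moreover have "exp (\<theta> * (- z)) \<le> cosh (\<theta> * B) + (- z) / B * sinh (\<theta> * B)"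
    using assms by (intro exp_le_chord) auto
  then have "exp (- (\<theta> * S)) * exp (- (\<theta> * z)) \<le> exp (- (\<theta> * S)) * (cosh (\<theta> * B) - z / B * sinh (\<theta> * B))"
    by (intro mult_left_mono) auto
  ultimately have "exp (\<theta> * S) * exp (\<theta> * z) + exp (- (\<theta> * S)) * exp (- (\<theta> * z))
     \<le> exp (\<theta> * S) * (cosh (\<theta> * B) + z / B * sinh (\<theta> * B))
       + exp (- (\<theta> * S)) * (cosh (\<theta> * B) - z / B * sinh (\<theta> * B))"
    by (rule add_mono)
  also have "exp (\<theta> * S) * exp (\<theta> * z) + exp (- (\<theta> * S)) * exp (- (\<theta> * z))
      = 2 * cosh (\<theta> * (S + z))"
    by (simp add: cosh_field_def exp_add[symmetric] distrib_left)
  also have "exp (\<theta> * S) * (cosh (\<theta> * B) + z / B * sinh (\<theta> * B))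
       + exp (- (\<theta> * S)) * (cosh (\<theta> * B) - z / B * sinh (\<theta> * B))
     = 2 * (cosh (\<theta> * S) * cosh (\<theta> * B) + sinh (\<theta> * S) * (z / B * sinh (\<theta> * B)))"
    unfolding cosh_field_def[of "\<theta> * S"] sinh_field_def[of "\<theta> * S"]
    by (simp add: field_split_simps) (simp add: algebra_simps)?
  finally show ?thesis by simp
qed

text \<open>Hoeffding's inequality with a union bound, derandomised by the method of conditional
  expectations: the hypothesis on \<open>\<omega>\<close> replaces independent mean-zero random choices, and the
  potential \<open>\<Sum>x. exp (- \<theta>\<^sup>2 / 2 * (\<Sum>i. (B i x)\<^sup>2)) * cosh (\<theta> * S x)\<close> never increases.\<close>

lemma balancing_potential:
  fixes z :: "'i \<Rightarrow> 'b \<Rightarrow> 'x \<Rightarrow> real" and \<theta> :: real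
  assumes "finite I" "finite X"
    and bound: "\<And>i b x. i \<in> I \<Longrightarrow> b \<in> A i \<Longrightarrow> x \<in> X \<Longrightarrow> \<bar>z i b x\<bar> \<le> B i x"
    and choice: "\<And>i \<omega>. i \<in> I \<Longrightarrow> \<exists>b\<in>A i. (\<Sum>x\<in>X. \<omega> x * z i b x) \<le> 0"
  shows "\<exists>b. (\<forall>i\<in>I. b i \<in> A i) \<and>
    (\<Sum>x\<in>X. exp (- (\<theta>\<^sup>2 / 2 * (\<Sum>i\<in>I. (B i x)\<^sup>2))) * cosh (\<theta> * (\<Sum>i\<in>I. z i (b i) x))) \<le> card X"
  using assms(1) bound choice
proof (induction I rule: finite_induct)
  case empty
  then show ?case by simp
next
  case (insert i I)
  obtain b where b: "\<forall>i\<in>I. b i \<in> A i"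
    "(\<Sum>x\<in>X. exp (- (\<theta>\<^sup>2 / 2 * (\<Sum>i\<in>I. (B i x)\<^sup>2))) * cosh (\<theta> * (\<Sum>i\<in>I. z i (b i) x))) \<le> card X"
    using insert.IH[OF insert.prems] by auto
  define S where "S = (\<lambda>x. \<Sum>i\<in>I. z i (b i) x)"
  define e where "e = (\<lambda>x. exp (- (\<theta>\<^sup>2 / 2 * (\<Sum>i\<in>I. (B i x)\<^sup>2))))"
  \<comment> \<open>The damping contributed by the new index; it absorbs the factor
    \<open>cosh (\<theta> * B i x)\<close>.\<close>
  define e1 where "e1 = (\<lambda>x. exp (- ((\<theta> * B i x)\<^sup>2 / 2)))"
  \<comment> \<open>The coefficient of \<open>z i d x\<close> in the damped chord bound. It depends
    on the earlier choices only, so \<open>d\<close> may be selected after it.\<close>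
  define \<omega> where "\<omega> = (\<lambda>x. e x * e1 x * (sinh (\<theta> * S x) * (sinh (\<theta> * B i x) / B i x)))"
  obtain d where d: "d \<in> A i" "(\<Sum>x\<in>X. \<omega> x * z i d x) \<le> 0"
    using insert.prems(2)[of i \<omega>] by auto
  define b' where "b' = b(i := d)"
  have S': "(\<Sum>j\<in>insert i I. z j (b' j) x) = S x + z i d x" for x
  proof -
    have "(\<Sum>j\<in>I. z j (b' j) x) = S x"
      unfolding S_def using insert.hyps by (intro sum.cong) (auto simp: b'_def)
    then show ?thesis using insert.hyps by (simp add: b'_def)
  qed
  have e': "exp (- (\<theta>\<^sup>2 / 2 * (\<Sum>j\<in>insert i I. (B j x)\<^sup>2))) = e x * e1 x" for x
    using insert.hyps
    by (simp add: e_def e1_def exp_add[symmetric] power_mult_distrib distrib_left add.commute)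
  have summand: "e x * e1 x * cosh (\<theta> * (S x + z i d x)) \<le> e x * cosh (\<theta> * S x) + \<omega> x * z i d x"
    if "x \<in> X" for x
  proof -
    have "e x * e1 x * cosh (\<theta> * (S x + z i d x))
        \<le> e x * e1 x * (cosh (\<theta> * S x) * cosh (\<theta> * B i x)
            + sinh (\<theta> * S x) * (z i d x / B i x * sinh (\<theta> * B i x)))"
      using insert.prems(1)[of i d x] d that
      by (intro mult_left_mono cosh_add_le_chord) (auto simp: e_def e1_def)
    also have "\<dots> = e x * cosh (\<theta> * S x) * (e1 x * cosh (\<theta> * B i x)) + \<omega> x * z i d x"
      by (simp add: \<omega>_def algebra_simps)
    also have "e1 x * cosh (\<theta> * B i x) \<le> e1 x * exp ((\<theta> * B i x)\<^sup>2 / 2)"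
      by (intro mult_left_mono cosh_le_exp_half_square) (auto simp: e1_def)
    also have "\<dots> = 1" by (simp add: e1_def exp_add[symmetric])
    finally show ?thesis by (simp add: mult_left_mono e_def)
  qed
  have "(\<Sum>x\<in>X. e x * e1 x * cosh (\<theta> * (S x + z i d x)))
      \<le> (\<Sum>x\<in>X. e x * cosh (\<theta> * S x) + \<omega> x * z i d x)"
    by (intro sum_mono summand)
  also have "\<dots> \<le> card X" using b(2) d(2) by (simp add: sum.distrib e_def S_def)
  finally have "(\<Sum>x\<in>X. exp (- (\<theta>\<^sup>2 / 2 * (\<Sum>j\<in>insert i I. (B j x)\<^sup>2))) *
      cosh (\<theta> * (\<Sum>j\<in>insert i I. z j (b' j) x))) \<le> card X"
    unfolding S' e' .
  moreover have "\<forall>j\<in>insert i I. b' j \<in> A j" using b(1) d(1) by (simp add: b'_def)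
  ultimately show ?case by blast
qed

text \<open>All summands of the potential are nonnegative, so each one is at most
  \<open>card X\<close>; since \<open>cosh u \<ge> exp \<bar>u\<bar> / 2\<close>, this bounds every
  deviation simultaneously.\<close>

lemma balanced_choice:
  fixes z :: "'i \<Rightarrow> 'b \<Rightarrow> 'x \<Rightarrow> real"
  assumes "finite I" "finite X" "D > 0"
    and bound: "\<And>i b x. i \<in> I \<Longrightarrow> b \<in> A i \<Longrightarrow> x \<in> X \<Longrightarrow> \<bar>z i b x\<bar> \<le> B i x"
    and total: "\<And>x. x \<in> X \<Longrightarrow> (\<Sum>i\<in>I. (B i x)\<^sup>2) \<le> D"
    and choice: "\<And>i \<omega>. i \<in> I \<Longrightarrow> \<exists>b\<in>A i. (\<Sum>x\<in>X. \<omega> x * z i b x) \<le> 0"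
  shows "\<exists>b. (\<forall>i\<in>I. b i \<in> A i) \<and>
    (\<forall>x\<in>X. \<bar>\<Sum>i\<in>I. z i (b i) x\<bar> \<le> sqrt (2 * D * ln (2 * card X)))"
proof (cases "X = {}")
  case True
  have "\<forall>i\<in>I. \<exists>b. b \<in> A i" using choice[of _ "\<lambda>_. 0"] by blast
  then obtain b where "\<forall>i\<in>I. b i \<in> A i" by (rule bchoice[THEN exE])
  with True show ?thesis by (intro exI[of _ b]) simp
next
  case False
  then have "card X \<ge> 1" using assms(2) by (simp add: Suc_leI card_gt_0_iff)
  define M where "M = ln (2 * real (card X))"
  have "M > 0" using \<open>card X \<ge> 1\<close> by (simp add: M_def)
  \<comment> \<open>With this value \<open>\<theta>\<^sup>2 / 2 * D = M\<close>, so the damping and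
    the cardinality of \<open>X\<close> each cost a factor \<open>exp M\<close>, and the resulting
    bound \<open>2 * M / \<theta>\<close> equals \<open>sqrt (2 * D * M)\<close>.\<close>
  define \<theta> where "\<theta> = sqrt (2 * M / D)"
  have \<theta>: "\<theta> > 0" "\<theta>\<^sup>2 = 2 * M / D" using \<open>M > 0\<close> \<open>D > 0\<close> by (auto simp: \<theta>_def)
  obtain b where b: "\<forall>i\<in>I. b i \<in> A i"
    "(\<Sum>x\<in>X. exp (- (\<theta>\<^sup>2 / 2 * (\<Sum>i\<in>I. (B i x)\<^sup>2))) * cosh (\<theta> * (\<Sum>i\<in>I. z i (b i) x))) \<le> card X"
    using balancing_potential[where z = z and A = A and B = B and \<theta> = \<theta>, OF assms(1,2) bound choice] by auto
  have "\<bar>\<Sum>i\<in>I. z i (b i) x\<bar> \<le> sqrt (2 * D * M)" if "x \<in> X" for x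
  proof -
    define S where "S = (\<Sum>i\<in>I. z i (b i) x)"
    have "exp (- M) * (exp (\<theta> * \<bar>S\<bar>) / 2) \<le> exp (- (\<theta>\<^sup>2 / 2 * (\<Sum>i\<in>I. (B i x)\<^sup>2))) * cosh (\<theta> * S)"
    proof (intro mult_mono)
      have "\<theta>\<^sup>2 / 2 * (\<Sum>i\<in>I. (B i x)\<^sup>2) \<le> \<theta>\<^sup>2 / 2 * D"
        using total[OF that] by (intro mult_left_mono) auto
      also have "\<dots> = M" using \<theta>(2) \<open>D > 0\<close> by simp
      finally show "exp (- M) \<le> exp (- (\<theta>\<^sup>2 / 2 * (\<Sum>i\<in>I. (B i x)\<^sup>2)))" by simp
      have "cosh (\<theta> * S) = cosh (\<theta> * \<bar>S\<bar>)"
        using cosh_real_abs[of "\<theta> * S"] \<theta>(1) by (simp add: abs_mult)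
      then show "exp (\<theta> * \<bar>S\<bar>) / 2 \<le> cosh (\<theta> * S)"
        using exp_ge_zero[of "- (\<theta> * \<bar>S\<bar>)"]
        by (simp only: cosh_field_def) (auto simp: field_simps)
    qed auto
    also have "\<dots> \<le> (\<Sum>x\<in>X. exp (- (\<theta>\<^sup>2 / 2 * (\<Sum>i\<in>I. (B i x)\<^sup>2))) * cosh (\<theta> * (\<Sum>i\<in>I. z i (b i) x)))"
      unfolding S_def using that assms(2)
      by (intro member_le_sum[where f = "\<lambda>x. exp (- (\<theta>\<^sup>2 / 2 * (\<Sum>i\<in>I. (B i x)\<^sup>2))) * cosh (\<theta> * (\<Sum>i\<in>I. z i (b i) x))"]) auto
    also have "\<dots> \<le> card X" by (rule b(2))
    also have "\<dots> = exp M / 2" using \<open>card X \<ge> 1\<close> by (simp add: M_def)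
    finally have "exp (\<theta> * \<bar>S\<bar>) \<le> exp M * exp M"
      by (simp add: exp_minus field_simps)
    then have "\<theta> * \<bar>S\<bar> \<le> 2 * M" by (simp add: exp_add[symmetric])
    then have "\<bar>S\<bar> \<le> 2 * M / \<theta>" using \<theta>(1) by (simp add: field_simps)
    also have "\<dots> = sqrt ((2 * M / \<theta>)\<^sup>2)" using \<theta>(1) \<open>M > 0\<close> by simp
    also have "(2 * M / \<theta>)\<^sup>2 = 2 * D * M"
      unfolding power_divide \<theta>(2) using \<open>M > 0\<close> \<open>D > 0\<close> by (simp add: power2_eq_square)
    finally show ?thesis unfolding S_def .
  qed
  with b(1) show ?thesis unfolding M_def by (intro exI[of _ b]) simp
qed

section \<open>Thinning out a finite system of point masses\<close>

text \<open>The finite core of the argument: atom \<open>k\<close> has mass \<open>m k\<close> and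
  signed density \<open>s k\<close>, \<open>h x\<close> is the kernel at a net point, and
  \<open>J\<close> indexes the moments to be preserved. These moments make cells outside
  \<open>bad x\<close> exact, so only the mass of the bad cells enters the variance bound for
  \<open>balanced_choice\<close>.\<close>

lemma sparse_discretisation:
  fixes h :: "'x \<Rightarrow> 'k \<Rightarrow> real" and m s :: "'k \<Rightarrow> real" and f :: "'j \<Rightarrow> 'k \<Rightarrow> real"
    and cell :: "'k \<Rightarrow> 'c" and bad :: "'x \<Rightarrow> 'c set" and N :: nat
  assumes "finite J" "finite K" "finite X" "N > 0" "D > 0" "\<delta> > 0"
    and m: "\<And>k. k \<in> K \<Longrightarrow> 0 \<le> m k" "sum m K \<le> 1"
    and s: "\<And>k. k \<in> K \<Longrightarrow> \<bar>s k\<bar> \<le> 1"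
    and cells: "card (cell ` K) \<le> N"
    and osc: "\<And>x k k'. x \<in> X \<Longrightarrow> k \<in> K \<Longrightarrow> k' \<in> K \<Longrightarrow> cell k = cell k' \<Longrightarrow> \<bar>h x k - h x k'\<bar> \<le> \<delta>"
    and good: "\<And>x c d. x \<in> X \<Longrightarrow> c \<in> cell ` K \<Longrightarrow> c \<notin> bad x \<Longrightarrow>
        (\<And>j. j \<in> J \<Longrightarrow> (\<Sum>k | k \<in> K \<and> cell k = c. d k * f j k) = 0) \<Longrightarrow>
        (\<Sum>k | k \<in> K \<and> cell k = c. d k * h x k) = 0"
    and mass: "\<And>x. x \<in> X \<Longrightarrow> (\<Sum>k | k \<in> K \<and> cell k \<in> bad x. m k) \<le> D"
  shows "\<exists>W. card {k\<in>K. W k \<noteq> 0} \<le> 2 * (card J + 2) * N \<and> (\<Sum>k\<in>K. \<bar>W k\<bar>) \<le> 1 \<and>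
    (\<forall>x\<in>X. \<bar>(\<Sum>k\<in>K. W k * h x k) - (\<Sum>k\<in>K. m k * s k * h x k)\<bar>
       \<le> sqrt (2 * (4 * \<delta>\<^sup>2 * D / N) * ln (2 * card X)))"
proof -
  define C where "C = cell ` K"
  define Kc where "Kc = (\<lambda>c. {k. k \<in> K \<and> cell k = c})"
  define M where "M = (\<lambda>c. sum m (Kc c))"
  \<comment> \<open>Rounding up gives every copy of a cell mass at most \<open>1 / N\<close>. As
    there are at most \<open>N\<close> cells of total mass at most 1, there are at most
    \<open>2 * N\<close> copies.\<close>
  define n where "n = (\<lambda>c. nat \<lceil>N * M c\<rceil>)"
  define P where "P = Sigma C (\<lambda>c. {..<n c})"
  define a where "a = (\<lambda>c k. m k / n c)"
  have fin: "finite C" "\<And>c. finite (Kc c)" "finite P"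
    using assms(2) by (auto simp: C_def Kc_def P_def)
  have m_nonneg: "0 \<le> m k" if "k \<in> Kc c" for c k using that m(1) by (auto simp: Kc_def)
  have by_cells: "sum u K = (\<Sum>c\<in>C. sum u (Kc c))" for u :: "'k \<Rightarrow> real"
    unfolding C_def Kc_def using assms(2) by (rule sum.image_gen)
  have M_nonneg: "0 \<le> M c" for c
    unfolding M_def by (intro sum_nonneg m_nonneg)
  have NM: "N * M c \<le> n c" "n c \<le> N * M c + 1" for c
    using M_nonneg[of c] by (auto simp: n_def)
  \<comment> \<open>A cell without copies has mass 0, hence so do its atoms, and the division by 0
    in \<open>a\<close> loses nothing.\<close>
  have n_a: "n c * a c k = m k" if "k \<in> Kc c" for c k
  proof (cases "n c = 0")
    case True
    then have "real N * M c \<le> 0" using NM(1)[of c] by simp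
    then have "M c \<le> 0" using \<open>N > 0\<close> by (simp add: mult_le_0_iff)
    moreover have "m k \<le> M c"
      unfolding M_def using that fin(2) m_nonneg by (intro member_le_sum) blast+
    ultimately have "m k = 0" using m_nonneg[OF that] by simp
    then show ?thesis by (simp add: a_def)
  qed (simp add: a_def)
  have a_nonneg: "0 \<le> a c k" if "k \<in> Kc c" for c k
    using m_nonneg[OF that] by (simp add: a_def)
  have sum_a: "sum (a c) (Kc c) = M c / n c" for c
    by (simp add: a_def M_def sum_divide_distrib)
  have sum_M: "(\<Sum>c\<in>C. M c) \<le> 1"
    using m(2) by_cells[of m] by (simp add: M_def)
  \<comment> \<open>The moments make good cells exact, the signed total allows a constant to be
    subtracted from \<open>h x\<close> on a bad cell, and the unsigned total controls both the error
    and the total variation of \<open>W\<close>.\<close>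
  define admissible where "admissible = (\<lambda>c b. (\<forall>k\<in>Kc c. 0 \<le> b k) \<and>
      card {k\<in>Kc c. b k \<noteq> 0} \<le> card J + 2 \<and>
      (\<forall>j\<in>J. (\<Sum>k\<in>Kc c. b k * (s k * f j k)) = (\<Sum>k\<in>Kc c. a c k * (s k * f j k))) \<and>
      (\<Sum>k\<in>Kc c. b k * s k) = (\<Sum>k\<in>Kc c. a c k * s k) \<and> sum b (Kc c) = sum (a c) (Kc c))"
  define A where "A = (\<lambda>p::'c \<times> nat. Collect (admissible (fst p)))"
  define z where "z = (\<lambda>(p::'c \<times> nat) b x. \<Sum>k\<in>Kc (fst p). (b k - a (fst p) k) * s k * h x k)"
  define B where "B = (\<lambda>(p::'c \<times> nat) x.
     if fst p \<in> bad x then 2 * \<delta> * (M (fst p) / n (fst p)) else 0)"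
  have ex: "\<exists>b\<in>A p. (\<Sum>x\<in>X. \<omega> x * z p b x) \<le> 0" if "p \<in> P" for p and \<omega> :: "'x \<Rightarrow> real"
  proof -
    define c where "c = fst p"
    \<comment> \<open>\<open>None\<close> adds the signed total to the \<open>card J\<close>
      moments, and \<open>sparse_nonneg_solution\<close> allows one further atom because it also
      preserves the mass; hence \<open>card J + 2\<close>.\<close>
    define f' where "f' = case_option s (\<lambda>j k. s k * f j k)"
    \<comment> \<open>Up to a constant, the weighted error is linear in \<open>b\<close> with these
      coefficients, and it vanishes at \<open>b = a c\<close>. A solution that does at least as well
      as \<open>a c\<close> therefore makes it nonpositive.\<close>
    define L where "L = (\<lambda>k. \<Sum>x\<in>X. \<omega> x * (s k * h x k))"
    have card: "card (insert None (Some ` J)) = Suc (card J)"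
      using \<open>finite J\<close> by (simp add: card_image)
    obtain b where b: "\<forall>k\<in>Kc c. 0 \<le> b k"
        "card {k\<in>Kc c. b k \<noteq> 0} \<le> Suc (card (insert None (Some ` J)))"
        "\<forall>j\<in>insert None (Some ` J). (\<Sum>k\<in>Kc c. b k * f' j k) = (\<Sum>k\<in>Kc c. a c k * f' j k)"
        "sum b (Kc c) = sum (a c) (Kc c)" "(\<Sum>k\<in>Kc c. b k * L k) \<le> (\<Sum>k\<in>Kc c. a c k * L k)"
      using sparse_nonneg_solution[of "insert None (Some ` J)" "Kc c" "a c" f' L]
        \<open>finite J\<close> fin(2) a_nonneg by auto
    have "admissible c b"
      using b(1,2,4) b(3)[rule_format, of None] b(3)[rule_format, of "Some _"] card
      by (auto simp: admissible_def f'_def)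
    moreover have "(\<Sum>x\<in>X. \<omega> x * z p b x) = (\<Sum>k\<in>Kc c. (b k - a c k) * L k)"
      unfolding z_def L_def c_def[symmetric] sum_distrib_left
      by (subst sum.swap) (simp add: mult_ac)
    ultimately show ?thesis
      using b(5) by (intro bexI[of _ b]) (auto simp: A_def c_def left_diff_distrib sum_subtractf)
  qed
  have z_bound: "\<bar>z p b x\<bar> \<le> B p x" if "p \<in> P" "b \<in> A p" "x \<in> X" for p b x
  proof -
    define c where "c = fst p"
    have c: "c \<in> cell ` K" using that(1) by (auto simp: P_def C_def c_def)
    have adm: "admissible c b" using that(2) by (simp add: A_def c_def)
    have z: "z p b x = (\<Sum>k\<in>Kc c. (b k - a c k) * s k * h x k)" by (simp add: z_def c_def)
    show ?thesis
    proof (cases "c \<in> bad x")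
      case False
      have "(\<Sum>k\<in>Kc c. ((b k - a c k) * s k) * f j k) = 0" if "j \<in> J" for j
        using adm that by (simp add: admissible_def left_diff_distrib sum_subtractf mult.assoc)
      then have "z p b x = 0" unfolding z using good[OF that(3) c False] by (simp add: Kc_def)
      then show ?thesis using False by (simp add: B_def c_def)
    next
      case True
      \<comment> \<open>As the signed totals agree, the value at a reference atom can be subtracted,
        which replaces \<open>h x\<close> by its oscillation on the cell.\<close>
      obtain k0 where k0: "k0 \<in> Kc c" using c by (auto simp: Kc_def)
      have "(\<Sum>k\<in>Kc c. (b k - a c k) * s k) = 0"
        using adm by (simp add: admissible_def left_diff_distrib sum_subtractf)
      then have "(\<Sum>k\<in>Kc c. (b k - a c k) * s k * h x k0) = 0"
        by (simp add: sum_distrib_right[symmetric])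
      then have "z p b x = (\<Sum>k\<in>Kc c. (b k - a c k) * s k * (h x k - h x k0))"
        unfolding z by (simp add: right_diff_distrib sum_subtractf)
      also have "\<bar>\<dots>\<bar> \<le> (\<Sum>k\<in>Kc c. (b k + a c k) * 1 * \<delta>)"
      proof (rule order_trans[OF sum_abs], intro sum_mono)
        fix k assume k: "k \<in> Kc c"
        have "\<bar>b k - a c k\<bar> \<le> b k + a c k"
          using adm a_nonneg[OF k] k by (auto simp: admissible_def)
        moreover have "\<bar>s k\<bar> \<le> 1" using s k by (auto simp: Kc_def)
        moreover have "\<bar>h x k - h x k0\<bar> \<le> \<delta>"
          using osc[OF that(3)] k k0 by (auto simp: Kc_def)
        ultimately show "\<bar>(b k - a c k) * s k * (h x k - h x k0)\<bar> \<le> (b k + a c k) * 1 * \<delta>"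
          unfolding abs_mult by (intro mult_mono) auto
      qed
      also have "\<dots> = 2 * \<delta> * (M c / n c)"
        using adm by (simp add: sum_a[symmetric] admissible_def sum_distrib_right[symmetric] sum.distrib)
      finally show ?thesis using True by (simp add: B_def c_def)
    qed
  qed
  have total: "(\<Sum>p\<in>P. (B p x)\<^sup>2) \<le> 4 * \<delta>\<^sup>2 * D / N" if "x \<in> X" for x
  proof -
    have "(\<Sum>p\<in>P. (B p x)\<^sup>2) = (\<Sum>c\<in>C. \<Sum>q<n c. (B (c, q) x)\<^sup>2)"
      unfolding P_def using fin by (subst sum.Sigma) (auto simp: case_prod_beta)
    also have "\<dots> \<le> (\<Sum>c\<in>C. if c \<in> bad x then 4 * \<delta>\<^sup>2 / N * M c else 0)"
    proof (intro sum_mono)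
      fix c
      \<comment> \<open>The gain from splitting: the squared masses of the copies add up to at most
        the mass of the cell times \<open>1 / N\<close>.\<close>
      have "n c * (M c / n c)\<^sup>2 \<le> M c / N"
      proof (cases "n c = 0")
        case True then show ?thesis using M_nonneg by simp
      next
        case False
        have "n c * (M c / n c)\<^sup>2 = M c * (M c / n c)"
          using False by (simp add: power2_eq_square)
        also have "M c / n c \<le> 1 / N"
          using NM(1)[of c] False \<open>N > 0\<close> by (simp add: field_simps)
        finally show ?thesis using M_nonneg[of c] by (simp add: mult_left_mono)
      qed
      then have "4 * \<delta>\<^sup>2 * (n c * (M c / n c)\<^sup>2) \<le> 4 * \<delta>\<^sup>2 / N * M c"
        using mult_left_mono[of "n c * (M c / n c)\<^sup>2" "M c / N" "4 * \<delta>\<^sup>2"] by simp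
      moreover have "(\<Sum>q<n c. (2 * \<delta> * (M c / n c))\<^sup>2) = 4 * \<delta>\<^sup>2 * (n c * (M c / n c)\<^sup>2)"
        unfolding power_mult_distrib by simp
      ultimately have "(\<Sum>q<n c. (2 * \<delta> * (M c / n c))\<^sup>2) \<le> 4 * \<delta>\<^sup>2 / N * M c"
        by (simp only:)
      then show "(\<Sum>q<n c. (B (c, q) x)\<^sup>2) \<le> (if c \<in> bad x then 4 * \<delta>\<^sup>2 / N * M c else 0)"
        by (cases "c \<in> bad x") (simp_all only: B_def fst_conv if_True if_False, simp)
    qed
    also have "\<dots> = 4 * \<delta>\<^sup>2 / N * (\<Sum>c\<in>C. sum (\<lambda>k. if cell k \<in> bad x then m k else 0) (Kc c))"
      unfolding sum_distrib_left by (intro sum.cong) (auto simp: M_def Kc_def sum_distrib_left)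
    also have "\<dots> = 4 * \<delta>\<^sup>2 / N * (\<Sum>k | k \<in> K \<and> cell k \<in> bad x. m k)"
      using assms(2) by (simp add: by_cells[symmetric] sum.inter_filter)
    also have "\<dots> \<le> 4 * \<delta>\<^sup>2 / N * D"
      using mass[OF that] by (intro mult_left_mono) auto
    finally show ?thesis by simp
  qed
  have "4 * \<delta>\<^sup>2 * D / N > 0" using assms(4-6) by simp
  from balanced_choice[where z = z and A = A and B = B, OF fin(3) assms(3) this z_bound total ex]
  obtain b where b: "\<And>p. p \<in> P \<Longrightarrow> admissible (fst p) (b p)"
      "\<And>x. x \<in> X \<Longrightarrow> \<bar>\<Sum>p\<in>P. z p (b p) x\<bar> \<le> sqrt (2 * (4 * \<delta>\<^sup>2 * D / N) * ln (2 * card X))"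
    by (auto simp: A_def)
  \<comment> \<open>Copies of one cell live on the same atoms, so their signed weights are added
    back together.\<close>
  define W where "W = (\<lambda>k. \<Sum>q<n (cell k). b (cell k, q) k * s k)"
  have W_sum: "(\<Sum>k\<in>K. \<Sum>q<n (cell k). u (cell k, q) k) = (\<Sum>p\<in>P. \<Sum>k\<in>Kc (fst p). u p k)"
    for u :: "'c \<times> nat \<Rightarrow> 'k \<Rightarrow> real"
  proof -
    have "(\<Sum>k\<in>K. \<Sum>q<n (cell k). u (cell k, q) k) = (\<Sum>c\<in>C. \<Sum>k\<in>Kc c. \<Sum>q<n c. u (c, q) k)"
      unfolding by_cells by (intro sum.cong) (auto simp: Kc_def)
    also have "\<dots> = (\<Sum>c\<in>C. \<Sum>q<n c. \<Sum>k\<in>Kc c. u (c, q) k)"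
      by (intro sum.cong refl sum.swap)
    also have "\<dots> = (\<Sum>p\<in>P. \<Sum>k\<in>Kc (fst p). u p k)"
      unfolding P_def using fin by (subst sum.Sigma) (auto simp: case_prod_beta)
    finally show ?thesis .
  qed
  have in_P: "(cell k, q) \<in> P" if "k \<in> K" "q < n (cell k)" for k q
    using that by (auto simp: P_def C_def)
  have "card {k\<in>K. W k \<noteq> 0} \<le> 2 * (card J + 2) * N"
  proof -
    have "{k\<in>K. W k \<noteq> 0} \<subseteq> (\<Union>p\<in>P. {k\<in>Kc (fst p). b p k \<noteq> 0})"
    proof
      fix k assume k: "k \<in> {k\<in>K. W k \<noteq> 0}"
      then obtain q where "q < n (cell k)" "b (cell k, q) k \<noteq> 0"
        unfolding W_def by (auto elim!: sum.not_neutral_contains_not_neutral)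
      then show "k \<in> (\<Union>p\<in>P. {k\<in>Kc (fst p). b p k \<noteq> 0})"
        using in_P k by (intro UN_I[of "(cell k, q)"]) (auto simp: Kc_def)
    qed
    then have "card {k\<in>K. W k \<noteq> 0} \<le> card (\<Union>p\<in>P. {k\<in>Kc (fst p). b p k \<noteq> 0})"
      using fin by (intro card_mono) auto
    also have "\<dots> \<le> (\<Sum>p\<in>P. card {k\<in>Kc (fst p). b p k \<noteq> 0})"
      by (rule card_UN_le[OF fin(3)])
    also have "\<dots> \<le> (\<Sum>p\<in>P. card J + 2)"
      using b(1) by (intro sum_mono) (auto simp: admissible_def)
    also have "\<dots> = card P * (card J + 2)" by simp
    also have "\<dots> \<le> 2 * N * (card J + 2)"
    proof (rule mult_right_mono)
      have "real (card P) = (\<Sum>c\<in>C. real (n c))"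
        unfolding P_def using fin by (subst card_SigmaI) auto
      also have "\<dots> \<le> (\<Sum>c\<in>C. N * M c + 1)" by (intro sum_mono NM)
      also have "\<dots> = N * (\<Sum>c\<in>C. M c) + card C" by (simp add: sum.distrib sum_distrib_left)
      also have "\<dots> \<le> real N * 1 + real N"
        using sum_M cells by (intro add_mono mult_left_mono) (auto simp: C_def)
      finally show "card P \<le> 2 * N" by linarith
    qed simp
    finally show ?thesis by (simp add: mult.commute mult.left_commute)
  qed
  moreover have "(\<Sum>k\<in>K. \<bar>W k\<bar>) \<le> 1"
  proof -
    have "(\<Sum>k\<in>K. \<bar>W k\<bar>) \<le> (\<Sum>k\<in>K. \<Sum>q<n (cell k). b (cell k, q) k)"
      unfolding W_def
    proof (intro sum_mono order_trans[OF sum_abs] sum_mono)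
      fix k q assume k: "k \<in> K" and "q \<in> {..<n (cell k)}"
      then have "admissible (cell k) (b (cell k, q))" using b(1)[OF in_P[of k q]] by simp
      then have "0 \<le> b (cell k, q) k" using k by (auto simp: admissible_def Kc_def)
      then show "\<bar>b (cell k, q) k * s k\<bar> \<le> b (cell k, q) k"
        using s[OF k] by (simp add: abs_mult mult_left_le)
    qed
    also have "\<dots> = (\<Sum>p\<in>P. \<Sum>k\<in>Kc (fst p). b p k)" by (rule W_sum)
    also have "\<dots> = (\<Sum>p\<in>P. M (fst p) / n (fst p))"
      using b(1) sum_a by (intro sum.cong) (auto simp: admissible_def)
    also have "\<dots> = (\<Sum>c\<in>C. \<Sum>q<n c. M c / n c)"
      unfolding P_def using fin by (subst sum.Sigma) (auto simp: case_prod_beta)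
    also have "\<dots> \<le> (\<Sum>c\<in>C. M c)" using M_nonneg by (intro sum_mono) auto
    finally show ?thesis using sum_M by simp
  qed
  moreover have "\<bar>(\<Sum>k\<in>K. W k * h x k) - (\<Sum>k\<in>K. m k * s k * h x k)\<bar>
       \<le> sqrt (2 * (4 * \<delta>\<^sup>2 * D / N) * ln (2 * card X))" if "x \<in> X" for x
  proof -
    have "(\<Sum>k\<in>K. m k * s k * h x k) = (\<Sum>k\<in>K. \<Sum>q<n (cell k). a (cell k) k * s k * h x k)"
    proof (intro sum.cong refl)
      fix k assume "k \<in> K"
      then have "n (cell k) * a (cell k) k = m k" by (intro n_a) (simp add: Kc_def)
      then show "m k * s k * h x k = (\<Sum>q<n (cell k). a (cell k) k * s k * h x k)"
        by (simp add: mult.assoc[symmetric])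
    qed
    then have "(\<Sum>k\<in>K. W k * h x k) - (\<Sum>k\<in>K. m k * s k * h x k)
        = (\<Sum>k\<in>K. \<Sum>q<n (cell k). (b (cell k, q) k - a (cell k) k) * s k * h x k)"
      by (simp add: W_def sum_distrib_right sum_subtractf left_diff_distrib)
    also have "\<dots> = (\<Sum>p\<in>P. z p (b p) x)"
      using W_sum[of "\<lambda>p k. (b p k - a (fst p) k) * s k * h x k"] by (simp add: z_def)
    finally show ?thesis using b(2)[OF that] by simp
  qed
  ultimately show ?thesis by blast
qed

section \<open>Nets and measurable partitions\<close>

text \<open>A separated set of greatest cardinality is a net, since a point far from it could be
  added. Its balls of radius \<open>\<eta> / 2\<close> are disjoint and each has mass at least
  \<open>v\<close>, which bounds the cardinality.\<close>

lemma exists_separated_net: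
  fixes \<mu> :: "'a::metric_space measure"
  assumes "prob_space \<mu>" "sets \<mu> = sets borel" "v > 0" "\<eta> > 0"
    and ball: "\<And>x. v \<le> measure \<mu> (ball x (\<eta> / 2))"
  shows "\<exists>C :: 'a set. finite C \<and> real (card C) * v \<le> 1 \<and> (\<forall>x. \<exists>c\<in>C. dist x c < \<eta>)"
proof -
  interpret prob_space \<mu> by fact
  define sep where "sep = (\<lambda>C::'a set. finite C \<and> (\<forall>x\<in>C. \<forall>y\<in>C. x \<noteq> y \<longrightarrow> \<eta> \<le> dist x y))"
  have card: "real (card C) * v \<le> 1" if "sep C" for C
  proof -
    have "disjoint_family_on (\<lambda>x. ball x (\<eta> / 2)) C"
    proof (unfold disjoint_family_on_def, intro ballI impI)
      fix x y assume xy: "x \<in> C" "y \<in> C" "x \<noteq> y"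
      have "\<eta> \<le> dist x y" using that xy by (auto simp: sep_def)
      then show "ball x (\<eta> / 2) \<inter> ball y (\<eta> / 2) = {}"
        by (intro disjoint_ballI) simp
    qed
    then have "prob (\<Union>x\<in>C. ball x (\<eta> / 2)) = (\<Sum>x\<in>C. prob (ball x (\<eta> / 2)))"
      using that assms(2) by (intro finite_measure_finite_Union) (auto simp: sep_def)
    moreover have "(\<Sum>x\<in>C. v) \<le> (\<Sum>x\<in>C. prob (ball x (\<eta> / 2)))"
      by (intro sum_mono ball)
    ultimately show ?thesis using prob_le_1[of "\<Union>x\<in>C. ball x (\<eta> / 2)"] by simp
  qed
  have "card C \<le> nat \<lceil>1 / v\<rceil>" if "sep C" for C
  proof -
    have "real (card C) \<le> 1 / v" using card[OF that] \<open>v > 0\<close> by (simp add: field_simps)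
    then show ?thesis by linarith
  qed
  then have "\<forall>C. sep C \<longrightarrow> card C < Suc (nat \<lceil>1 / v\<rceil>)" by (simp add: less_Suc_eq_le)
  moreover have "sep {}" by (simp add: sep_def)
  ultimately obtain C where C: "sep C" "\<And>C'. sep C' \<Longrightarrow> card C' \<le> card C"
    using ex_has_greatest_nat[of sep "{}" card "Suc (nat \<lceil>1 / v\<rceil>)"] by blast
  have "\<exists>c\<in>C. dist x c < \<eta>" for x
  proof (rule ccontr)
    assume far: "\<not> ?thesis"
    then have "sep (insert x C)" using C(1) by (auto simp: sep_def dist_commute not_less)
    moreover have "x \<notin> C" using far \<open>\<eta> > 0\<close> by auto
    ultimately show False using C(2)[of "insert x C"] C(1) by (simp add: sep_def)
  qed
  moreover have "finite C" using C(1) by (simp add: sep_def)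
  ultimately show ?thesis using card[OF C(1)] by blast
qed

text \<open>Each point receives the first centre within distance \<open>\<eta>\<close>. Taking the
  least index keeps the labelling Borel, and two points with the same centre are within
  \<open>2 * \<eta>\<close>.\<close>

lemma exists_measurable_partition:
  fixes C :: "'a::metric_space set"
  assumes "finite C" "\<And>x. \<exists>c\<in>C. dist x c < \<eta>"
  shows "\<exists>cl :: 'a \<Rightarrow> nat. cl \<in> borel \<rightarrow>\<^sub>M count_space UNIV \<and> (\<forall>x. cl x < card C) \<and>
    (\<forall>x y. cl x = cl y \<longrightarrow> dist x y \<le> 2 * \<eta>)"
proof -
  obtain e where e: "bij_betw e {0..<card C} C"
    using ex_bij_betw_nat_finite[OF assms(1)] by blast
  define cl where "cl = (\<lambda>x. LEAST i. i < card C \<and> dist x (e i) < \<eta>)"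
  have cl: "cl x < card C \<and> dist x (e (cl x)) < \<eta>" for x
  proof -
    obtain i where "i < card C \<and> dist x (e i) < \<eta>"
      using assms(2)[of x] bij_betw_imp_surj_on[OF e] by force
    then show ?thesis unfolding cl_def by (rule LeastI)
  qed
  have [measurable]: "(\<lambda>x. dist x c) \<in> borel_measurable borel" for c :: 'a
    by (intro borel_measurable_continuous_onI continuous_intros)
  have "cl \<in> borel \<rightarrow>\<^sub>M count_space UNIV"
    unfolding cl_def by measurable
  moreover have "dist x y \<le> 2 * \<eta>" if "cl x = cl y" for x y
    using cl[of x] cl[of y] dist_triangle2[of x y "e (cl x)"] that by simp
  ultimately show ?thesis using cl by blast
qed

section \<open>Lists of nodes, moments on a span, and shells\<close>

text \<open>Meets the demand for a prescribed number of nodes: surplus positions get weight 0 and an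
  arbitrary point.\<close>

lemma sparse_sum_as_list:
  fixes W :: "'k \<Rightarrow> real" and p :: "'k \<Rightarrow> 'a"
  assumes "finite K" "card {k\<in>K. W k \<noteq> 0} \<le> n"
  shows "\<exists>y w. \<forall>F :: 'a \<Rightarrow> real. (\<Sum>j = 1..n. w j * F (y j)) = (\<Sum>k\<in>K. W k * F (p k))"
proof -
  define T where "T = {k\<in>K. W k \<noteq> 0}"
  have T: "finite T" "T \<subseteq> K" using assms(1) by (auto simp: T_def)
  obtain e where e: "bij_betw e {1..card T} T"
    using ex_bij_betw_nat_finite_1[OF T(1)] by blast
  define w where "w = (\<lambda>j. if j \<le> card T then W (e j) else 0)"
  have "(\<Sum>j = 1..n. w j * F (p (e j))) = (\<Sum>k\<in>K. W k * F (p k))" for F :: "'a \<Rightarrow> real"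
  proof -
    have "(\<Sum>j = 1..n. w j * F (p (e j))) = (\<Sum>j = 1..card T. w j * F (p (e j)))"
      using assms(2) by (intro sum.mono_neutral_right) (auto simp: w_def T_def)
    also have "\<dots> = (\<Sum>j = 1..card T. W (e j) * F (p (e j)))"
      by (intro sum.cong) (auto simp: w_def)
    also have "\<dots> = (\<Sum>k\<in>T. W k * F (p k))"
      by (rule sum.reindex_bij_betw[OF e])
    also have "\<dots> = (\<Sum>k\<in>K. W k * F (p k))"
      using assms(1) by (intro sum.mono_neutral_left) (auto simp: T_def)
    finally show ?thesis .
  qed
  then show ?thesis by (intro exI[of _ "\<lambda>j. p (e j)"] exI[of _ w]) simp
qed

lemma sum_eq_0_on_span:
  fixes B :: "('a::topological_space \<Rightarrow>\<^sub>C real) set"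
  assumes "f \<in> span B" "\<And>b. b \<in> B \<Longrightarrow> (\<Sum>k\<in>T. d k * apply_bcontfun b (p k)) = 0"
  shows "(\<Sum>k\<in>T. d k * apply_bcontfun f (p k)) = 0"
proof -
  have "subspace {f. (\<Sum>k\<in>T. d k * apply_bcontfun f (p k)) = 0}"
    unfolding subspace_def
    by (auto simp: plus_bcontfun.rep_eq scaleR_bcontfun.rep_eq zero_bcontfun.rep_eq
        distrib_left sum.distrib mult.left_commute sum_distrib_left[symmetric])
  from span_minimal[OF _ this, of B] assms show ?thesis by blast
qed

text \<open>Let \<open>j \<ge> 1\<close> be the first index such that \<open>R\<close> meets the
  closed ball of radius \<open>t j\<close>; then \<open>R\<close> stays at distance at least
  \<open>t (j - 1)\<close>. If \<open>R\<close> also leaves this ball, it has points on both sides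
  of the sphere of radius \<open>t j\<close>, and its small diameter keeps it near that
  sphere.\<close>

lemma small_set_shell_dichotomy:
  fixes t :: "nat \<Rightarrow> real" and R :: "'a::metric_space set"
  assumes "t 0 = 0" "\<And>j. j < l \<Longrightarrow> t j < t (Suc j)" "l \<ge> 1"
    and far: "\<And>y. y \<in> R \<Longrightarrow> dist x y \<le> t l"
    and diam: "\<And>y z. y \<in> R \<Longrightarrow> z \<in> R \<Longrightarrow> dist y z \<le> \<delta>"
  shows "(\<exists>j\<in>{1..l}. R \<subseteq> shell x (t (j - 1)) (t j)) \<or>
    (\<exists>j\<in>{1..<l}. R \<subseteq> shell x (t j - \<delta>) (t j + \<delta>))"
proof (cases "R = {}")
  case True
  then show ?thesis using \<open>l \<ge> 1\<close> by (intro disjI1 bexI[of _ 1]) auto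
next
  case False
  define near where "near = (\<lambda>j. \<exists>y\<in>R. dist x y \<le> t j)"
  define i where "i = (LEAST j. near j)"
  have "near l" using far False by (auto simp: near_def)
  then have i: "near i" "i \<le> l" unfolding i_def by (rule LeastI, rule Least_le)
  have least: "t j < dist x y" if "j < i" "y \<in> R" for j y
    using not_less_Least[of j near] that unfolding i_def near_def by force
  \<comment> \<open>The least index is 0 exactly when \<open>x\<close> lies in \<open>R\<close>; the
    first shell is then the right one, with lower bound \<open>t 0 = 0\<close>.\<close>
  define j where "j = max 1 i"
  have j: "1 \<le> j" "j \<le> l" using i \<open>l \<ge> 1\<close> by (auto simp: j_def)
  have lower: "t (j - 1) \<le> dist x y" if "y \<in> R" for y
    using least[of "i - 1" y] that assms(1) by (cases "i = 0") (auto simp: j_def max_def)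
  have "near j"
  proof (cases "i = 0")
    case True
    then show ?thesis using i(1) assms(2)[of 0] \<open>l \<ge> 1\<close> unfolding near_def j_def by force
  next
    case False
    then show ?thesis using i(1) by (simp add: j_def max_def)
  qed
  then obtain y where y: "y \<in> R" "dist x y \<le> t j" by (auto simp: near_def)
  show ?thesis
  proof (cases "\<forall>z\<in>R. dist x z \<le> t j")
    case True
    then show ?thesis using j lower by (intro disjI1 bexI[of _ j]) (auto simp: shell_def)
  next
    case False
    then obtain y' where y': "y' \<in> R" "t j < dist x y'" by auto
    have "j < l" using far[OF y'(1)] y'(2) j(2) by (cases "j = l") auto
    moreover have "z \<in> shell x (t j - \<delta>) (t j + \<delta>)" if "z \<in> R" for z
      using diam[OF y(1) that] diam[OF that y'(1)] y(2) y'(2)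
        dist_triangle[of x z y] dist_triangle[of x y' z] by (simp add: shell_def)
    ultimately show ?thesis using j by (intro disjI2 bexI[of _ j]) auto
  qed
qed

section \<open>Replacing the integral by a finite sum\<close>

lemma (in prob_space) prob_vimage_eq_sum:
  fixes \<kappa> :: "'a \<Rightarrow> 'k::countable"
  assumes [measurable]: "\<kappa> \<in> M \<rightarrow>\<^sub>M count_space UNIV" and "finite K" "\<And>z. z \<in> space M \<Longrightarrow> \<kappa> z \<in> K"
  shows "(\<Sum>k | k \<in> K \<and> Q k. prob {z \<in> space M. \<kappa> z = k}) = prob {z \<in> space M. Q (\<kappa> z)}"
proof -
  have "{z \<in> space M. Q (\<kappa> z)} = (\<Union>k\<in>{k\<in>K. Q k}. {z \<in> space M. \<kappa> z = k})"
    using assms(3) by auto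
  also have "prob \<dots> = (\<Sum>k | k \<in> K \<and> Q k. prob {z \<in> space M. \<kappa> z = k})"
    using assms(2) by (intro finite_measure_finite_Union) (auto simp: disjoint_family_on_def)
  finally show ?thesis by simp
qed

text \<open>\<open>g\<close> is integrated exactly over each fibre of \<open>\<kappa>\<close> and
  only \<open>H\<close> is frozen at a representative point. Since \<open>g\<close> is bounded by 1
  almost everywhere, the error is at most the oscillation of \<open>H\<close>.\<close>

lemma (in prob_space) integral_discretisation:
  fixes \<kappa> :: "'a \<Rightarrow> 'k::countable" and g H :: "'a \<Rightarrow> real"
  assumes [measurable]: "\<kappa> \<in> M \<rightarrow>\<^sub>M count_space UNIV" "g \<in> borel_measurable M" "H \<in> borel_measurable M"
    and K: "finite K" "\<And>z. z \<in> space M \<Longrightarrow> \<kappa> z \<in> K"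
    and g: "AE z in M. \<bar>g z\<bar> \<le> 1"
    and H: "\<And>z. z \<in> space M \<Longrightarrow> \<bar>H z\<bar> \<le> B" "\<And>z. z \<in> space M \<Longrightarrow> \<bar>H z - H (p (\<kappa> z))\<bar> \<le> \<epsilon>"
  shows "\<bar>(LINT z|M. H z * g z) -
     (\<Sum>k\<in>K. (LINT z|M. indicator {z. \<kappa> z = k} z * g z) * H (p k))\<bar> \<le> \<epsilon>"
proof -
  have [measurable]: "(\<lambda>z. H (p (\<kappa> z))) \<in> borel_measurable M"
    by (rule measurable_compose[OF assms(1)]) simp
  have int1: "integrable M (\<lambda>z. indicator {z. \<kappa> z = k} z * g z)" for k
    by (rule integrable_const_bound[of _ 1], use g in eventually_elim) (auto simp: indicator_def)
  have int2: "integrable M (\<lambda>z. H z * g z)"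
  proof (rule integrable_const_bound[of _ B])
    show "AE z in M. norm (H z * g z) \<le> B"
      using g AE_space
    proof eventually_elim
      case (elim z)
      then have "\<bar>H z\<bar> * \<bar>g z\<bar> \<le> B * 1" using H(1)[of z] by (intro mult_mono) auto
      then show ?case by (simp add: abs_mult)
    qed
  qed measurable
  have "(\<Sum>k\<in>K. (LINT z|M. indicator {z. \<kappa> z = k} z * g z) * H (p k))
      = (LINT z|M. (\<Sum>k\<in>K. indicator {z. \<kappa> z = k} z * g z * H (p k)))"
    using int1 by (subst Bochner_Integration.integral_sum) auto
  also have "\<dots> = (LINT z|M. H (p (\<kappa> z)) * g z)"
  proof (intro Bochner_Integration.integral_cong refl)
    fix z assume z: "z \<in> space M"
    have "(\<Sum>k\<in>K. indicator {z. \<kappa> z = k} z * g z * H (p k)) = (\<Sum>k\<in>{\<kappa> z}. H (p k) * g z)"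
      using K(1) K(2)[OF z] by (intro sum.mono_neutral_cong_right) (auto simp: indicator_def)
    then show "(\<Sum>k\<in>K. indicator {z. \<kappa> z = k} z * g z * H (p k)) = H (p (\<kappa> z)) * g z" by simp
  qed
  finally have eq: "(\<Sum>k\<in>K. (LINT z|M. indicator {z. \<kappa> z = k} z * g z) * H (p k))
      = (LINT z|M. H (p (\<kappa> z)) * g z)" .
  have diff: "AE z in M. \<bar>(H z - H (p (\<kappa> z))) * g z\<bar> \<le> \<epsilon>"
    using g AE_space
  proof eventually_elim
    case (elim z)
    then have "\<bar>H z - H (p (\<kappa> z))\<bar> * \<bar>g z\<bar> \<le> \<epsilon> * 1" using H(2)[of z] by (intro mult_mono) auto
    then show ?case by (simp add: abs_mult)
  qed
  have int3: "integrable M (\<lambda>z. (H z - H (p (\<kappa> z))) * g z)"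
    by (rule integrable_const_bound[of _ \<epsilon>]) (use diff in auto)
  have int4: "integrable M (\<lambda>z. H (p (\<kappa> z)) * g z)"
    using Bochner_Integration.integrable_diff[OF int2 int3] by (simp add: algebra_simps)
  have "(LINT z|M. H z * g z) - (LINT z|M. H (p (\<kappa> z)) * g z)
      = (LINT z|M. (H z - H (p (\<kappa> z))) * g z)"
    using Bochner_Integration.integral_diff[OF int2 int4] by (simp add: left_diff_distrib)
  also have "\<bar>\<dots>\<bar> \<le> (LINT z|M. \<bar>(H z - H (p (\<kappa> z))) * g z\<bar>)"
    by (rule integral_abs_bound)
  also have "\<dots> \<le> (LINT z|M. \<epsilon>)"
    using int3 diff by (intro integral_mono_AE) auto
  also have "\<dots> = \<epsilon>" by (simp add: prob_space)
  finally show ?thesis unfolding eq .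
qed

section \<open>Numerical bookkeeping\<close>

text \<open>\<open>m\<close> stands for the size of a \<open>\<rho>\<close>-net, so
  \<open>ln (2 * m)\<close> is at most a multiple of \<open>\<beta> * c1 * ln N\<close>. The
  exponent in \<open>\<rho>\<close> is the one for which \<open>\<delta> ^ 3 / N\<close> is a
  constant multiple of \<open>\<rho>\<^sup>2\<close>.\<close>

lemma error_constants:
  fixes \<beta> c1 c2 \<rho> \<delta> :: real and l N m :: nat
  assumes "\<beta> \<ge> 1" "c1 > 1" "c2 > 1" "l \<ge> 1" "N \<ge> 20" "m > 0"
    and \<rho>: "\<rho> = real N powr (- 1 / 2 - 3 / (2 * \<beta>))"
    and \<delta>: "\<delta> = c1 / 2 * real N powr (- 1 / \<beta>)"
    and m: "real m * (4 * \<rho> / c1) powr \<beta> \<le> 1"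
  shows "3 * \<rho> + sqrt (2 * (4 * \<delta>\<^sup>2 * (l * c2 * \<delta>) / N) * ln (2 * m))
    \<le> 45 * (8 * c1\<^sup>2 * sqrt (c2 * l) * sqrt \<beta>) * \<rho> * sqrt (ln N)"
proof -
  define L where "L = ln (real N)"
  have "exp 1 \<le> real N" using exp_le \<open>N \<ge> 20\<close> by simp
  then have "ln (exp 1) \<le> L" unfolding L_def using \<open>N \<ge> 20\<close> by (subst ln_le_cancel_iff) auto
  then have L: "1 \<le> L" by simp
  have N: "real N > 0" using \<open>N \<ge> 20\<close> by simp
  have pos: "\<rho> > 0" "\<delta> > 0" using N \<open>c1 > 1\<close> by (auto simp: \<rho> \<delta>)
  have ln_\<rho>: "ln \<rho> = - ((1 / 2 + 3 / (2 * \<beta>)) * L)"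
    using N by (simp add: \<rho> L_def ln_powr left_diff_distrib distrib_right)
  have "ln (real m * (4 * \<rho> / c1) powr \<beta>) \<le> ln 1"
    using m \<open>m > 0\<close> pos \<open>c1 > 1\<close> by (subst ln_le_cancel_iff) auto
  then have "ln (real m) + \<beta> * ln (4 * \<rho> / c1) \<le> 0"
    using \<open>m > 0\<close> pos \<open>c1 > 1\<close> by (simp add: ln_mult ln_powr)
  moreover have "ln (4 * \<rho> / c1) = ln 4 + ln \<rho> - ln c1"
    using pos \<open>c1 > 1\<close> by (simp add: ln_div ln_mult)
  moreover have "0 \<le> ln (4::real)" by simp
  moreover have "ln c1 \<le> c1 - 1" using ln_le_minus_one \<open>c1 > 1\<close> by simp
  moreover have "- (2 * L) \<le> ln \<rho>"
  proof -
    have "1 / 2 + 3 / (2 * \<beta>) \<le> 2" using \<open>\<beta> \<ge> 1\<close> by (simp add: field_simps)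
    then have "(1 / 2 + 3 / (2 * \<beta>)) * L \<le> 2 * L" using L by (intro mult_right_mono) auto
    then show ?thesis unfolding ln_\<rho> by simp
  qed
  ultimately have "ln (real m) + \<beta> * (- (2 * L) - (c1 - 1)) \<le> 0"
    using mult_left_mono[of "- (2 * L) - (c1 - 1)" "ln (4 * \<rho> / c1)" \<beta>] \<open>\<beta> \<ge> 1\<close> by linarith
  moreover have "ln (2 * real m) \<le> 1 + ln (real m)"
    using \<open>m > 0\<close> ln_le_minus_one[of 2] by (simp add: ln_mult)
  ultimately have "ln (2 * real m) \<le> \<beta> * (2 * L + c1)"
    using \<open>\<beta> \<ge> 1\<close> by (simp add: algebra_simps)
  also have "\<dots> \<le> \<beta> * (3 * c1 * L)"
  proof -
    have "1 * L \<le> c1 * L" "c1 * 1 \<le> c1 * L" using L \<open>c1 > 1\<close> by (auto intro!: mult_mono)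
    then show ?thesis using \<open>\<beta> \<ge> 1\<close> by (intro mult_left_mono) auto
  qed
  finally have ln_m: "ln (2 * real m) \<le> \<beta> * (3 * c1 * L)" .
  have \<delta>3: "\<delta> ^ 3 / N = c1 ^ 3 / 8 * \<rho>\<^sup>2"
  proof -
    have "(real N powr (- 1 / \<beta>)) ^ 3 = real N powr (- 3 / \<beta>)"
      using N by (simp add: powr_power)
    moreover have "real N powr (- 3 / \<beta>) / N = real N powr (- 3 / \<beta> - 1)"
      using N by (simp add: powr_diff)
    moreover have "\<rho>\<^sup>2 = real N powr (- 3 / \<beta> - 1)"
    proof -
      have exponent: "2 * (- 1 / 2 - 3 / (2 * \<beta>)) = - 3 / \<beta> - 1" by (simp add: field_simps)
      have "real N powr (2 * (- 1 / 2 - 3 / (2 * \<beta>))) = \<rho>\<^sup>2"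
        using N by (simp only: \<rho> powr_power of_nat_numeral mult.commute)
      then show ?thesis unfolding exponent by simp
    qed
    moreover have "\<delta> ^ 3 / N = c1 ^ 3 / 8 * ((real N powr (- 1 / \<beta>)) ^ 3 / N)"
      by (simp add: \<delta> power_mult_distrib power_divide)
    ultimately show ?thesis by (simp only:)
  qed
  have "4 * \<delta>\<^sup>2 * (l * c2 * \<delta>) / N = 4 * l * c2 * (\<delta> ^ 3 / N)"
    by (simp add: power2_eq_square power3_eq_cube)
  then have D: "4 * \<delta>\<^sup>2 * (l * c2 * \<delta>) / N = l * c2 * c1 ^ 3 / 2 * \<rho>\<^sup>2"
    unfolding \<delta>3 by simp
  \<comment> \<open>The target is \<open>360 * (Q * \<rho>)\<close>. The radicand is at most
    \<open>3 * (Q * \<rho>)\<^sup>2\<close>, so the root costs at most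
    \<open>2 * (Q * \<rho>)\<close>, and \<open>1 \<le> Q\<close> lets the term
    \<open>3 * \<rho>\<close> be absorbed as well.\<close>
  define Q where "Q = c1\<^sup>2 * sqrt (c2 * l) * sqrt \<beta> * sqrt L"
  have Q1: "1 \<le> Q"
  proof -
    have "1 \<le> c1\<^sup>2" using \<open>c1 > 1\<close> by (simp add: power2_eq_square less_1_mult less_imp_le)
    moreover have "1 * 1 \<le> c2 * real l" using \<open>c2 > 1\<close> \<open>l \<ge> 1\<close> by (intro mult_mono) auto
    ultimately have "1 * 1 * 1 * 1 \<le> Q"
      unfolding Q_def using \<open>\<beta> \<ge> 1\<close> L by (intro mult_mono) auto
    then show ?thesis by simp
  qed
  have "2 * (4 * \<delta>\<^sup>2 * (l * c2 * \<delta>) / N) * ln (2 * m)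
      \<le> 2 * (4 * \<delta>\<^sup>2 * (l * c2 * \<delta>) / N) * (\<beta> * (3 * c1 * L))"
    using ln_m pos \<open>c2 > 1\<close> by (intro mult_left_mono) auto
  also have "\<dots> = 3 * (Q * \<rho>)\<^sup>2"
    unfolding D Q_def using \<open>c2 > 1\<close> \<open>\<beta> \<ge> 1\<close> L
    by (simp add: power_mult_distrib) (simp add: power2_eq_square power3_eq_cube power4_eq_xxxx mult_ac)
  also have "\<dots> \<le> (2 * (Q * \<rho>))\<^sup>2" by (simp add: power_mult_distrib)
  finally have "sqrt (2 * (4 * \<delta>\<^sup>2 * (l * c2 * \<delta>) / N) * ln (2 * m)) \<le> 2 * (Q * \<rho>)"
    using Q1 pos by (intro real_le_lsqrt) auto
  moreover have "1 * \<rho> \<le> Q * \<rho>" using Q1 pos by (intro mult_right_mono) auto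
  moreover have "0 \<le> Q * \<rho>" using Q1 pos by simp
  ultimately have "3 * \<rho> + sqrt (2 * (4 * \<delta>\<^sup>2 * (l * c2 * \<delta>) / N) * ln (2 * m)) \<le> 360 * (Q * \<rho>)"
    by linarith
  also have "\<dots> = 45 * (8 * c1\<^sup>2 * sqrt (c2 * l) * sqrt \<beta>) * \<rho> * sqrt (ln N)"
    by (simp add: Q_def L_def)
  finally show ?thesis .
qed

section \<open>Assembly on the metric space\<close>

theorem theorem5p3:
  fixes \<Phi> :: "real \<Rightarrow> real" and t :: "nat \<Rightarrow> real" and r l N :: nat
    and \<beta> c1 c2 c3 :: real and \<mu> :: "'a::metric_space measure" and g :: "'a \<Rightarrow> real"
  assumes "compact (UNIV :: 'a set)" and "path_connected (UNIV :: 'a set)"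
    and "diameter (UNIV :: 'a set) = pi"
    and "t 0 = 0" and "\<And>j. j < l \<Longrightarrow> t j < t (Suc j)" and "t l = pi"
    and "continuous_on {0..pi} \<Phi>"
    and "\<And>s s'. s \<in> {0..pi} \<Longrightarrow> s' \<in> {0..pi} \<Longrightarrow> \<bar>\<Phi> s - \<Phi> s'\<bar> \<le> \<bar>s - s'\<bar>"
    and "\<Phi> \<in> S_class TYPE('a) r l t"
    and "\<beta> \<ge> 1" and "c1 > 1" and "c2 > 1"
    and "prob_space \<mu>" and "sets \<mu> = sets borel" and "nonatomic \<mu>"
    and "\<And>\<tau>. 0 < \<tau> \<Longrightarrow> \<tau> \<le> 1 \<Longrightarrow>
           (INF x. measure \<mu> (ball x \<tau>)) \<ge> (8 / c1) powr \<beta> * \<tau> powr \<beta>"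
    and "\<And>x \<delta> j. 0 < \<delta> \<Longrightarrow> \<delta> < pi \<Longrightarrow> 1 \<le> j \<Longrightarrow> j < l \<Longrightarrow>
           measure \<mu> (shell x (t j - \<delta>) (t j + \<delta>)) \<le> c2 * \<delta>"
    and "g \<in> borel_measurable \<mu>" and "Linf_norm \<mu> g \<le> 1"
    and "N \<ge> 20"
    and "c3 = 8 * c1\<^sup>2 * sqrt (c2 * real l) * sqrt \<beta>"
  shows "\<exists>(y :: nat \<Rightarrow> 'a) (w :: nat \<Rightarrow> real). \<forall>x.
           \<bar>(LINT z|\<mu>. \<Phi> (dist x z) * g z) - (\<Sum>j = 1..2 * (r + 2) * N. w j * \<Phi> (dist x (y j)))\<bar>
             \<le> 45 * c3 * real N powr (- 1 / 2 - 3 / (2 * \<beta>)) * sqrt (ln (real N))"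
proof -
  interpret prob_space \<mu> by fact
  have space: "space \<mu> = UNIV" using sets_eq_imp_space_eq[OF assms(14)] by simp
  have meas_\<mu>: "f \<in> \<mu> \<rightarrow>\<^sub>M M' \<longleftrightarrow> f \<in> borel \<rightarrow>\<^sub>M M'" for f and M' :: "'b measure"
    using measurable_cong_sets[OF assms(14) refl] by blast
  have dist_le: "dist x y \<le> pi" for x y :: 'a
    using diameter_bounded_bound[OF compact_imp_bounded[OF assms(1)], of x y] assms(3) by simp
  have lip: "\<bar>\<Phi> (dist x y) - \<Phi> (dist x' y)\<bar> \<le> dist x x'" for x x' y :: 'a
    using assms(8)[of "dist x y" "dist x' y"] dist_le[of x y] dist_le[of x' y]
      dist_triangle[of x y x'] dist_triangle[of x' y x] by (simp add: dist_commute)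
  have lip': "\<bar>\<Phi> (dist x y) - \<Phi> (dist x y')\<bar> \<le> dist y y'" for x y y' :: 'a
    using lip[of y x y'] by (simp add: dist_commute)
  have l: "l \<ge> 1" using assms(4,6) by (cases l) auto
  have N: "real N > 0" "N > 0" using assms(20) by auto

  have ball_mass: "(4 * \<eta> / c1) powr \<beta> \<le> measure \<mu> (ball x (\<eta> / 2))" if "0 < \<eta>" "\<eta> \<le> 2" for \<eta> x
  proof -
    have "(4 * \<eta> / c1) powr \<beta> = (8 / c1) powr \<beta> * (\<eta> / 2) powr \<beta>"
      using that assms(11) by (subst powr_mult[symmetric]) (auto simp: field_simps)
    also have "\<dots> \<le> (INF x. measure \<mu> (ball x (\<eta> / 2)))" using that by (intro assms(16)) auto
    also have "\<dots> \<le> measure \<mu> (ball x (\<eta> / 2))"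
      by (intro cINF_lower bdd_belowI[of _ 0]) auto
    finally show ?thesis .
  qed
  have net: "\<exists>C :: 'a set. finite C \<and> real (card C) * (4 * \<eta> / c1) powr \<beta> \<le> 1 \<and> (\<forall>x. \<exists>c\<in>C. dist x c < \<eta>)"
    if "0 < \<eta>" "\<eta> \<le> 2" for \<eta>
    using that assms(11) ball_mass
    by (intro exists_separated_net[OF assms(13,14)]) auto

  define \<rho> where "\<rho> = real N powr (- 1 / 2 - 3 / (2 * \<beta>))"
  \<comment> \<open>Chosen so that \<open>(4 * (\<delta> / 2) / c1) powr \<beta> = 1 / N\<close>: a
    net of mesh \<open>\<delta> / 2\<close> then has at most \<open>N\<close> points, and the cells
    around them have diameter at most \<open>\<delta>\<close>.\<close>
  define \<delta> where "\<delta> = c1 / 2 * real N powr (- 1 / \<beta>)"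
  \<comment> \<open>There are \<open>l - 1\<close> interior spheres, and the
    \<open>\<delta>\<close>-neighbourhood of each has mass at most
    \<open>c2 * \<delta>\<close>.\<close>
  define D where "D = l * c2 * \<delta>"
  have \<rho>: "0 < \<rho>" "\<rho> \<le> 1"
  proof -
    show "0 < \<rho>" using N by (simp add: \<rho>_def)
    have "0 \<le> 3 / (2 * \<beta>)" using assms(10) by simp
    then have "- 1 / 2 - 3 / (2 * \<beta>) \<le> 0" by linarith
    then have "\<rho> \<le> real N powr 0" unfolding \<rho>_def using assms(20) by (intro powr_mono) auto
    then show "\<rho> \<le> 1" using N by simp
  qed
  have \<delta>: "0 < \<delta>" using N assms(11) by (simp add: \<delta>_def)
  have D: "0 < D" using \<delta> l assms(12) by (simp add: D_def)

  obtain cl :: "'a \<Rightarrow> nat" and n where cl: "cl \<in> borel \<rightarrow>\<^sub>M count_space UNIV" "\<And>x. cl x < n"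
      "\<And>x y. cl x = cl y \<Longrightarrow> dist x y \<le> \<delta>" "n \<le> N"
  proof (cases "\<delta> / 2 \<le> 2")
    case True
    obtain C :: "'a set" where C: "finite C" "real (card C) * (4 * (\<delta> / 2) / c1) powr \<beta> \<le> 1"
        "\<And>x. \<exists>c\<in>C. dist x c < \<delta> / 2"
      using net[of "\<delta> / 2"] True \<delta> by auto
    have "4 * (\<delta> / 2) / c1 = real N powr (- 1 / \<beta>)" using assms(11) by (simp add: \<delta>_def)
    moreover have "(real N powr (- 1 / \<beta>)) powr \<beta> = real N powr (- 1)"
      using assms(10) by (simp only: powr_powr) simp
    ultimately have eq: "(4 * (\<delta> / 2) / c1) powr \<beta> = 1 / N"
      using N by (simp add: powr_minus_divide)
    have "card C \<le> N" using C(2) N unfolding eq by (simp add: field_simps)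
    with exists_measurable_partition[OF C(1,3)] that show ?thesis by auto
  next
    case False
    \<comment> \<open>Here \<open>\<delta>\<close> exceeds 4 and thus the diameter
      \<open>pi\<close>, so the whole space serves as a single cell.\<close>
    then have "dist x y \<le> \<delta>" for x y :: 'a using dist_le[of x y] pi_less_4 by linarith
    then show ?thesis using that[of "\<lambda>_. 0" 1] N by simp
  qed
  obtain atom :: "'a \<Rightarrow> nat" and n' where atom: "atom \<in> borel \<rightarrow>\<^sub>M count_space UNIV" "\<And>x. atom x < n'"
      "\<And>x y. atom x = atom y \<Longrightarrow> dist x y \<le> \<rho>"
  proof -
    obtain C :: "'a set" where C: "finite C" "\<And>x. \<exists>c\<in>C. dist x c < \<rho> / 2"
      using net[of "\<rho> / 2"] \<rho> by auto
    from exists_measurable_partition[OF C] that show ?thesis by auto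
  qed
  obtain X :: "'a set" where X: "finite X" "real (card X) * (4 * \<rho> / c1) powr \<beta> \<le> 1"
      "\<And>x. \<exists>c\<in>X. dist x c < \<rho>"
    using net[of \<rho>] \<rho> by auto
  have "card X > 0" using X(1,3) by (auto simp: card_gt_0_iff)

  \<comment> \<open>Coarse cells govern the moment matching, fine ones the error
    \<open>\<rho>\<close> of replacing \<open>g d\<mu>\<close> by point masses. An atom is a
    nonempty intersection of the two kinds, represented by the point \<open>p k\<close>.\<close>
  define \<kappa> where "\<kappa> = (\<lambda>z. (cl z, atom z))"
  define K where "K = range \<kappa>"
  define p where "p = (\<lambda>k. SOME z. \<kappa> z = k)"
  have "K \<subseteq> {..<n} \<times> {..<n'}" using cl(2) atom(2) by (auto simp: K_def \<kappa>_def)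
  then have "finite K" by (rule finite_subset) simp
  have \<kappa>_p: "\<kappa> (p k) = k" if "k \<in> K" for k
    using that unfolding p_def K_def by (auto intro: someI)
  have cl_p: "cl (p k) = fst k" if "k \<in> K" for k
    using arg_cong[OF \<kappa>_p[OF that], of fst] by (simp add: \<kappa>_def)
  have [measurable]: "cl \<in> \<mu> \<rightarrow>\<^sub>M count_space UNIV" "atom \<in> \<mu> \<rightarrow>\<^sub>M count_space UNIV"
    using cl(1) atom(1) by (simp_all add: meas_\<mu>)
  have \<kappa>_meas[measurable]: "\<kappa> \<in> \<mu> \<rightarrow>\<^sub>M count_space UNIV"
    unfolding \<kappa>_def by measurable
  have \<kappa>_K: "\<kappa> z \<in> K" for z by (simp add: K_def)
  have [measurable]: "g \<in> borel_measurable \<mu>" by fact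
  have g: "AE z in \<mu>. \<bar>g z\<bar> \<le> 1"
  proof -
    have "AE z in \<mu>. ereal \<bar>g z\<bar> \<le> Linf_norm \<mu> g" unfolding Linf_norm_def by (rule esssup_AE)
    then show ?thesis
    proof eventually_elim
      case (elim z)
      then have "ereal \<bar>g z\<bar> \<le> 1" using assms(19) by (rule order_trans)
      then show ?case by (simp add: one_ereal_def)
    qed
  qed

  define m where "m = (\<lambda>k. prob {z \<in> space \<mu>. \<kappa> z = k})"
  define wt where "wt = (\<lambda>k. LINT z|\<mu>. indicator {z. \<kappa> z = k} z * g z)"
  \<comment> \<open>The mean of \<open>g\<close> over the atom. On a null atom \<open>wt k\<close>
    vanishes too, so \<open>m k * s k = wt k\<close> survives the division by 0.\<close>
  define s where "s = (\<lambda>k. wt k / m k)"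
  have wt_m: "\<bar>wt k\<bar> \<le> m k" for k
  proof -
    have "\<bar>wt k\<bar> \<le> (LINT z|\<mu>. \<bar>indicator {z. \<kappa> z = k} z * g z\<bar>)"
      unfolding wt_def by (rule integral_abs_bound)
    also have "\<dots> \<le> (LINT z|\<mu>. indicator {z. \<kappa> z = k} z)"
    proof (rule integral_mono_AE)
      show "integrable \<mu> (\<lambda>z. \<bar>indicator {z. \<kappa> z = k} z * g z\<bar>)"
        by (rule integrable_const_bound[of _ 1], use g in eventually_elim) (auto simp: indicator_def)
      show "integrable \<mu> (indicator {z. \<kappa> z = k} :: 'a \<Rightarrow> real)"
        by (rule integrable_const_bound[of _ 1]) (auto simp: indicator_def)
      show "AE z in \<mu>. \<bar>indicator {z. \<kappa> z = k} z * g z\<bar> \<le> indicator {z. \<kappa> z = k} z"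
        using g by eventually_elim (auto simp: indicator_def)
    qed
    also have "\<dots> = m k" by (simp add: m_def space)
    finally show ?thesis .
  qed
  have m_nonneg: "0 \<le> m k" for k by (simp add: m_def)
  have m_s: "m k * s k = wt k" for k using wt_m[of k] by (auto simp: s_def)
  have s_le: "\<bar>s k\<bar> \<le> 1" for k
    using wt_m[of k] m_nonneg[of k] by (cases "m k = 0") (auto simp: s_def field_simps)
  have sum_m: "(\<Sum>k | k \<in> K \<and> Q k. m k) = prob {z. Q (\<kappa> z)}" for Q
    using prob_vimage_eq_sum[OF \<kappa>_meas \<open>finite K\<close> \<kappa>_K, of Q] by (simp add: m_def space)

  obtain V :: "('a \<Rightarrow>\<^sub>C real) set" where V: "has_dim V r"
      "\<And>x j. j \<in> {1..l} \<Longrightarrow> \<exists>f\<in>V. \<forall>y\<in>shell x (t (j - 1)) (t j). \<Phi> (dist x y) = apply_bcontfun f y"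
    using assms(9) unfolding S_class_def by blast
  obtain B where B: "B \<subseteq> V" "independent B" "V \<subseteq> span B" "card B = r"
    using basis_exists[of V] V(1) unfolding has_dim_def by metis
  \<comment> \<open>Finiteness has to come from a finite spanning set: for \<open>r = 0\<close>,
    \<open>card B = r\<close> would not exclude an infinite \<open>B\<close>.\<close>
  obtain B0 where "finite B0" "V \<subseteq> span B0" using V(1) unfolding has_dim_def by blast
  then have "finite B" using independent_span_bound[of B0 B] B(1,2) by blast

  define h where "h = (\<lambda>x k. \<Phi> (dist x (p k)))"
  \<comment> \<open>On a cell inside one shell, the kernel at \<open>x\<close> agrees with some
    element of \<open>V\<close>, so equal moments against the basis \<open>B\<close> force zero
    error there.\<close>
  define bad where "bad = (\<lambda>x. {c. \<not> (\<exists>j\<in>{1..l}. {z. cl z = c} \<subseteq> shell x (t (j - 1)) (t j))})"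
  have good_cell: "(\<Sum>k | k \<in> K \<and> fst k = c. d k * h x k) = 0"
    if good: "c \<notin> bad x" and d: "\<And>b. b \<in> B \<Longrightarrow> (\<Sum>k | k \<in> K \<and> fst k = c. d k * apply_bcontfun b (p k)) = 0"
    for x c d
  proof -
    obtain j where j: "j \<in> {1..l}" "{z. cl z = c} \<subseteq> shell x (t (j - 1)) (t j)"
      using good unfolding bad_def by blast
    obtain f where f: "f \<in> V" "\<And>y. y \<in> shell x (t (j - 1)) (t j) \<Longrightarrow> \<Phi> (dist x y) = apply_bcontfun f y"
      using V(2)[OF j(1)] by blast
    have "(\<Sum>k | k \<in> K \<and> fst k = c. d k * apply_bcontfun f (p k)) = 0"
      by (rule sum_eq_0_on_span[of f B]) (use f(1) B(3) d in auto)
    moreover have "h x k = apply_bcontfun f (p k)" if "k \<in> K" "fst k = c" for k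
      using f(2)[of "p k"] j(2) cl_p[OF that(1)] that(2) by (auto simp: h_def)
    ultimately show ?thesis by simp
  qed
  have bad_mass: "(\<Sum>k | k \<in> K \<and> fst k \<in> bad x. m k) \<le> D" for x
  proof -
    have eq: "(\<Sum>k | k \<in> K \<and> fst k \<in> bad x. m k) = prob {z. cl z \<in> bad x}"
      using sum_m[of "\<lambda>k. fst k \<in> bad x"] by (simp add: \<kappa>_def)
    show ?thesis
    proof (cases "\<delta> < pi")
      case True
      have shell_sets: "shell x a b \<in> sets \<mu>" for a b
      proof -
        have "shell x a b = cball x b - ball x a" by (auto simp: shell_def)
        then show ?thesis by (simp add: assms(14))
      qed
      have "{z. cl z \<in> bad x} \<subseteq> (\<Union>j\<in>{1..<l}. shell x (t j - \<delta>) (t j + \<delta>))"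
      proof
        fix z assume z: "z \<in> {z. cl z \<in> bad x}"
        have "(\<exists>j\<in>{1..l}. {y. cl y = cl z} \<subseteq> shell x (t (j - 1)) (t j)) \<or>
            (\<exists>j\<in>{1..<l}. {y. cl y = cl z} \<subseteq> shell x (t j - \<delta>) (t j + \<delta>))"
          using dist_le cl(3) assms(6)
          by (intro small_set_shell_dichotomy[OF assms(4,5) l]) auto
        then show "z \<in> (\<Union>j\<in>{1..<l}. shell x (t j - \<delta>) (t j + \<delta>))"
          using z unfolding bad_def by blast
      qed
      then have "prob {z. cl z \<in> bad x} \<le> prob (\<Union>j\<in>{1..<l}. shell x (t j - \<delta>) (t j + \<delta>))"
        using shell_sets by (intro finite_measure_mono) auto
      also have "\<dots> \<le> (\<Sum>j\<in>{1..<l}. prob (shell x (t j - \<delta>) (t j + \<delta>)))"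
        using shell_sets by (intro finite_measure_subadditive_finite) auto
      also have "\<dots> \<le> (\<Sum>j\<in>{1..<l}. c2 * \<delta>)"
        using True \<delta> by (intro sum_mono assms(17)) auto
      also have "\<dots> \<le> D"
        using \<delta> assms(12) by (simp add: D_def mult.assoc mult_right_mono)
      finally show ?thesis unfolding eq .
    next
      case False
      \<comment> \<open>The shell estimate is available only for \<open>\<delta> < pi\<close>;
        otherwise \<open>D \<ge> 1\<close>, and any probability is at most \<open>D\<close>.\<close>
      then have "1 \<le> \<delta>" using pi_ge_two by linarith
      then have "1 * 1 * 1 \<le> real l * c2 * \<delta>" using l assms(12) by (intro mult_mono) auto
      then show ?thesis unfolding eq D_def using prob_le_1[of "{z. cl z \<in> bad x}"] by linarith
    qed
  qed
  have osc: "\<bar>h x k - h x k'\<bar> \<le> \<delta>" if "k \<in> K" "k' \<in> K" "fst k = fst k'" for x k k'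
    using lip'[of x "p k" "p k'"] cl(3)[of "p k" "p k'"] cl_p[OF that(1)] cl_p[OF that(2)] that(3)
    by (simp add: h_def)
  have "fst ` K \<subseteq> {..<n}" using cl(2) by (auto simp: K_def \<kappa>_def)
  then have "card (fst ` K) \<le> N" using card_mono[of "{..<n}" "fst ` K"] cl(4) by simp
  moreover have "sum m K \<le> 1" using sum_m[of "\<lambda>_. True"] by simp
  ultimately obtain W where W: "card {k\<in>K. W k \<noteq> 0} \<le> 2 * (card B + 2) * N" "(\<Sum>k\<in>K. \<bar>W k\<bar>) \<le> 1"
      "\<And>x. x \<in> X \<Longrightarrow> \<bar>(\<Sum>k\<in>K. W k * h x k) - (\<Sum>k\<in>K. m k * s k * h x k)\<bar>
         \<le> sqrt (2 * (4 * \<delta>\<^sup>2 * D / N) * ln (2 * card X))"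
    using sparse_discretisation[OF \<open>finite B\<close> \<open>finite K\<close> X(1) N(2) D \<delta>, where m = m and s = s
        and cell = fst and h = h and bad = bad and f = "\<lambda>b k. apply_bcontfun b (p k)"]
      m_nonneg s_le osc good_cell bad_mass by blast
  obtain y :: "nat \<Rightarrow> 'a" and w where yw:
      "\<And>F :: 'a \<Rightarrow> real. (\<Sum>j = 1..2 * (r + 2) * N. w j * F (y j)) = (\<Sum>k\<in>K. W k * F (p k))"
    using sparse_sum_as_list[OF \<open>finite K\<close> W(1), of p] unfolding B(4) by blast

  define I where "I = (\<lambda>x. LINT z|\<mu>. \<Phi> (dist x z) * g z)"
  define S where "S = (\<lambda>x. \<Sum>j = 1..2 * (r + 2) * N. w j * \<Phi> (dist x (y j)))"
  have S: "S x = (\<Sum>k\<in>K. W k * h x k)" for x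
    unfolding S_def h_def by (rule yw)
  have \<Phi>_cont: "continuous_on UNIV (\<lambda>z. \<Phi> (dist x z))" for x :: 'a
    using dist_le by (intro continuous_on_compose2[OF assms(7)] continuous_intros) auto
  have \<Phi>_meas[measurable]: "(\<lambda>z. \<Phi> (dist x z)) \<in> borel_measurable \<mu>" for x :: 'a
    unfolding meas_\<mu> by (rule borel_measurable_continuous_onI[OF \<Phi>_cont])
  have \<Phi>_bound: "\<bar>\<Phi> (dist x z)\<bar> \<le> \<bar>\<Phi> 0\<bar> + pi" for x z :: 'a
    using assms(8)[of "dist x z" 0] dist_le[of x z] by auto
  have int: "integrable \<mu> (\<lambda>z. \<Phi> (dist x z) * g z)" for x
  proof (rule integrable_const_bound[of _ "\<bar>\<Phi> 0\<bar> + pi"])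
    show "AE z in \<mu>. norm (\<Phi> (dist x z) * g z) \<le> \<bar>\<Phi> 0\<bar> + pi"
      using g
    proof eventually_elim
      case (elim z)
      then have "\<bar>\<Phi> (dist x z)\<bar> * \<bar>g z\<bar> \<le> (\<bar>\<Phi> 0\<bar> + pi) * 1"
        using \<Phi>_bound[of x z] by (intro mult_mono) auto
      then show ?case by (simp add: abs_mult)
    qed
  qed measurable
  have I_lip: "\<bar>I x - I x'\<bar> \<le> dist x x'" for x x'
  proof -
    have "I x - I x' = (LINT z|\<mu>. (\<Phi> (dist x z) - \<Phi> (dist x' z)) * g z)"
      unfolding I_def using int by (simp add: left_diff_distrib)
    also have "\<bar>\<dots>\<bar> \<le> (LINT z|\<mu>. \<bar>(\<Phi> (dist x z) - \<Phi> (dist x' z)) * g z\<bar>)"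
      by (rule integral_abs_bound)
    also have "\<dots> \<le> (LINT z|\<mu>. dist x x')"
    proof (rule integral_mono_AE)
      show "integrable \<mu> (\<lambda>z. \<bar>(\<Phi> (dist x z) - \<Phi> (dist x' z)) * g z\<bar>)"
        using int by (simp add: left_diff_distrib)
      show "AE z in \<mu>. \<bar>(\<Phi> (dist x z) - \<Phi> (dist x' z)) * g z\<bar> \<le> dist x x'"
        using g
      proof eventually_elim
        case (elim z)
        then have "\<bar>\<Phi> (dist x z) - \<Phi> (dist x' z)\<bar> * \<bar>g z\<bar> \<le> dist x x' * 1"
          using lip[of x z x'] by (intro mult_mono) auto
        then show ?case by (simp add: abs_mult)
      qed
    qed simp
    also have "\<dots> = dist x x'" by (simp add: prob_space)
    finally show ?thesis .
  qed
  \<comment> \<open>The total variation of \<open>W\<close> is at most 1, so the sum inherits the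
    Lipschitz constant of the kernel, as the integral does.\<close>
  have S_lip: "\<bar>S x - S x'\<bar> \<le> dist x x'" for x x'
  proof -
    have "\<bar>S x - S x'\<bar> = \<bar>\<Sum>k\<in>K. W k * (h x k - h x' k)\<bar>"
      by (simp add: S right_diff_distrib sum_subtractf)
    also have "\<dots> \<le> (\<Sum>k\<in>K. \<bar>W k\<bar> * dist x x')"
    proof (rule order_trans[OF sum_abs], intro sum_mono)
      fix k
      show "\<bar>W k * (h x k - h x' k)\<bar> \<le> \<bar>W k\<bar> * dist x x'"
        using lip[of x "p k" x'] by (simp add: abs_mult h_def mult_left_mono)
    qed
    also have "\<dots> = (\<Sum>k\<in>K. \<bar>W k\<bar>) * dist x x'" by (simp add: sum_distrib_right)
    also have "\<dots> \<le> 1 * dist x x'" using W(2) by (intro mult_right_mono) auto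
    finally show ?thesis by simp
  qed
  have discr: "\<bar>I x - (\<Sum>k\<in>K. m k * s k * h x k)\<bar> \<le> \<rho>" for x
  proof -
    have "\<bar>\<Phi> (dist x z) - \<Phi> (dist x (p (\<kappa> z)))\<bar> \<le> \<rho>" for z
    proof -
      have "atom (p (\<kappa> z)) = atom z" using \<kappa>_p[OF \<kappa>_K[of z]] by (simp add: \<kappa>_def)
      then show ?thesis using atom(3)[of z "p (\<kappa> z)"] lip'[of x z "p (\<kappa> z)"] by simp
    qed
    then show ?thesis
      using integral_discretisation[OF \<kappa>_meas assms(18) \<Phi>_meas[of x] \<open>finite K\<close> \<kappa>_K g \<Phi>_bound]
      by (simp add: I_def m_s h_def wt_def)
  qed
  have "\<bar>I x - S x\<bar> \<le> 45 * c3 * \<rho> * sqrt (ln (real N))" for x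
  proof -
    obtain x' where x': "x' \<in> X" "dist x x' < \<rho>" using X(3) by blast
    \<comment> \<open>One \<open>\<rho>\<close> each for moving \<open>I\<close> and
      \<open>S\<close> from \<open>x\<close> to the net point \<open>x'\<close>, and one for the
      discretisation of the integral at \<open>x'\<close>.\<close>
    have "\<bar>I x - S x\<bar> \<le> 3 * \<rho> + sqrt (2 * (4 * \<delta>\<^sup>2 * D / N) * ln (2 * card X))"
      using I_lip[of x x'] S_lip[of x x'] discr[of x'] W(3)[OF x'(1)] x'(2) unfolding S[of x']
      by linarith
    also have "\<dots> \<le> 45 * c3 * \<rho> * sqrt (ln (real N))"
      unfolding assms(21) D_def
      by (rule error_constants[OF assms(10-12) l assms(20) \<open>card X > 0\<close> \<rho>_def \<delta>_def X(2)])
    finally show ?thesis .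
  qed
  then show ?thesis unfolding I_def S_def \<rho>_def by blast
qed

end
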